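(* Let $C$ and $\delta$ be an operator and a distance with the properties (C1)–(C4) stated in the context, put $\kappa:=\operatorname{cond}_2(C|_{\mathcal{L}^1_K(\mathcal{T})})$ and $$q:=\frac{\sqrt{\kappa}-1}{\sqrt{\kappa}+1}.$$ Then for every weight $\rho\in L^1(\Omega)$ with grading $\gamma_\rho<1/q$ (with respect to $\delta$; $1/q=\infty$ if $q=0$) the $L^2$-projection $Q$ onto $\mathcal{L}^1_K(\mathcal{T})$ satisfies $$\|\rho\,Qu\|_2\le\frac{6\gamma_\rho^3}{1-\gamma_\rho q}\,\|\rho u\|_2\qquad\text{for all }u\in L^2(\Omega).$$ In particular, the worst grading satisfies $\gamma_{\max}\ge 1/q$.
   Context: Let $d,K\in\mathbb{N}$ (both $\geq 1$), $\Omega\subset\mathbb{R}^d$ a bounded polyhedral (connected) domain, $\mathcal{T}$ a regular triangulation of $\Omega$ into closed simplices, $\mathcal{L}^1_K(\mathcal{T})$ the space of continuous functions on $\Omega$ that are polynomials of degree at most $K$ on each $T\in\mathcal{T}$, and $Q\colon L^2(\Omega)\to\mathcal{L}^1_K(\mathcal{T})$ the $L^2$-projection: $\langle Qu,v\rangle=\langle u,v\rangle$ for all $v\in\mathcal{L}^1_K(\mathcal{T})$. $\|\cdot\|_2$ is the norm of $L^2(\Omega)$. Properties of $C$ and $\delta$: (C1) $C\colon L^2(\Omega)\to\mathcal{L}^1_K(\mathcal{T})$ is linear and self-adjoint with respect to the $L^2$-inner product. (C2) $C|_{\mathcal{L}^1_K(\mathcal{T})}$ is $L^2$-elliptic (smallest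 eigenvalue positive), with condition number $\operatorname{cond}_2(C|_{\mathcal{L}^1_K(\mathcal{T})})=\lambda_{\max}(C|_{\mathcal{L}^1_K(\mathcal{T})})/\lambda_{\min}(C|_{\mathcal{L}^1_K(\mathcal{T})})<\infty$. (C3) There is a symmetric neighbor relation on distinct simplices of $\mathcal{T}$ such that neighbors $T,T'$ satisfy $T\cap T'\ne\emptyset$, and such that any two simplices can be joined by a chain of consecutive neighbors; $\delta(T,T')$ is the smallest $N\in\mathbb{N}_0$ such that there are $T_0=T,\dots,T_N=T'$ in $\mathcal{T}$ with $T_{j-1},T_j$ neighbors for $j=1,\dots,N$. (C4) If $v\in L^2(\Omega)$ is supported on a collection $L\subset\mathcal{T}$, then every $T'\in\mathcal{T}$ with $T'\subset\operatorname{supp}(Cv)$ satisfies $\min_{T\in L}\delta(T',T)\le1$. A positive function $\rho\in L^1(\Omega)$ is a weight with grading $\gamma_\rho\ge1$ (with respect to $\delta$) if for all $T,T'\in\mathcal{T}$: $\operatorname{ess\,sup}_T\rho\le\gamma_\rho\operatorname{ess\,inf}_T\rho$; and if $\delta(T,T')=1$, then $\operatorname{ess\,sup}_{T'}\rho\le\gamma_\rho\operatorname{ess\,sup}_T\rho$ and $\operatorname{ess\,inf}_{T'}\rho\le\gamma_\rho\operatorname{ess\,inf}_T\rho$. The worst grading $\gamma_{\max}$ is the largest number such that for all weights $\rho\in L^1(\Omega)$ with grading $\gamma_\rho<\gamma_{\max}$ there is a constant $C(\gamma_\rho)<\infty$, depending on $\rho$ only through $\gamma_\rho$, with $\|\rho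 Qu\|_2\le C(\gamma_\rho)\|\rho u\|_2$ for all $u\in L^2(\Omega)$. *)

theory Defs
  imports "HOL-Analysis.Analysis" "HOL-Probability.Essential_Supremum"
begin

text \<open>
  Elements of \<open>L\<^sup>2(\<Omega>)\<close> and \<open>L\<^sup>1(\<Omega>)\<close> are represented by real functions on the ambient space;
  only their restriction to \<open>\<Omega>\<close>, up to null sets, matters.
\<close>

definition L2 :: "'a::euclidean_space set \<Rightarrow> ('a \<Rightarrow> real) set" where
  "L2 \<Omega> = {u \<in> borel_measurable (lebesgue_on \<Omega>). integrable (lebesgue_on \<Omega>) (\<lambda>x. (u x)\<^sup>2)}"

definition L2_inner :: "'a::euclidean_space set \<Rightarrow> ('a \<Rightarrow> real) \<Rightarrow> ('a \<Rightarrow> real) \<Rightarrow> real" where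
  "L2_inner \<Omega> u v = (LINT x|lebesgue_on \<Omega>. u x * v x)"

definition L2_norm :: "'a::euclidean_space set \<Rightarrow> ('a \<Rightarrow> real) \<Rightarrow> real" where
  "L2_norm \<Omega> u = sqrt (LINT x|lebesgue_on \<Omega>. (u x)\<^sup>2)"

text \<open>
  The essential support is a closed subset of the ambient space (contained in \<open>closure \<Omega>\<close>), not
  merely relatively closed in \<open>\<Omega>\<close>, so that it can contain closed simplices touching the boundary.
\<close>

definition ess_support :: "'a::euclidean_space set \<Rightarrow> ('a \<Rightarrow> real) \<Rightarrow> 'a set" where
  "ess_support \<Omega> u =
     {x. \<forall>U. open U \<and> x \<in> U \<longrightarrow> \<not> (AE y in lebesgue_on \<Omega>. y \<in> U \<longrightarrow> u y = 0)}"

definition polyhedral_domain :: "'a::euclidean_space set \<Rightarrow> bool" where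
  "polyhedral_domain \<Omega> \<longleftrightarrow>
     open \<Omega> \<and> connected \<Omega> \<and> bounded \<Omega> \<and> \<Omega> \<noteq> {} \<and>
     (\<exists>\<F>. finite \<F> \<and> (\<forall>F\<in>\<F>. polytope F) \<and> frontier \<Omega> = \<Union>\<F>)"

text \<open>
  Regularity (the intersection of two simplices is empty or a common face) is part of
  \<^const>\<open>triangulation\<close>. If \<open>\<Omega>\<close> is the interior of its closure, then \<open>interior T \<subseteq> \<Omega>\<close> is automatic;
  for a slit domain it says that the mesh resolves the slit.
\<close>

definition triangulation_of :: "'a::euclidean_space set set \<Rightarrow> 'a set \<Rightarrow> bool" where
  "triangulation_of \<T> \<Omega> \<longleftrightarrow>
     triangulation \<T> \<and> (\<forall>T\<in>\<T>. int DIM('a) simplex T) \<and>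
     \<Union>\<T> = closure \<Omega> \<and> (\<forall>T\<in>\<T>. interior T \<subseteq> \<Omega>)"

text \<open>
  The total degree is bounded by \<open>K\<close>. Multi-indices are functions vanishing off the (finite) basis,
  which makes the index set of the sum finite.
\<close>

definition polynomial_deg_le :: "nat \<Rightarrow> ('a::euclidean_space \<Rightarrow> real) \<Rightarrow> bool" where
  "polynomial_deg_le K p \<longleftrightarrow>
     (\<exists>c :: ('a \<Rightarrow> nat) \<Rightarrow> real. \<forall>x.
        p x = (\<Sum>\<alpha> | (\<forall>b. b \<notin> Basis \<longrightarrow> \<alpha> b = 0) \<and> (\<Sum>b\<in>Basis. \<alpha> b) \<le> K.
                 c \<alpha> * (\<Prod>b\<in>Basis. (x \<bullet> b) ^ \<alpha> b)))"

definition lagrange_space ::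
  "nat \<Rightarrow> 'a::euclidean_space set set \<Rightarrow> 'a set \<Rightarrow> ('a \<Rightarrow> real) set" where
  "lagrange_space K \<T> \<Omega> =
     {f. continuous_on \<Omega> f \<and>
         (\<forall>T\<in>\<T>. \<exists>p. polynomial_deg_le K p \<and> (\<forall>x \<in> T \<inter> \<Omega>. f x = p x))}"

definition L2_projection ::
  "'a::euclidean_space set \<Rightarrow> ('a \<Rightarrow> real) set \<Rightarrow> (('a \<Rightarrow> real) \<Rightarrow> 'a \<Rightarrow> real) \<Rightarrow> bool" where
  "L2_projection \<Omega> V Q \<longleftrightarrow>
     (\<forall>u \<in> L2 \<Omega>. Q u \<in> V \<and> (\<forall>v\<in>V. L2_inner \<Omega> (Q u) v = L2_inner \<Omega> u v))"

text \<open>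
  The second conjunct says that the map on representatives induces a map on \<open>L\<^sup>2(\<Omega>)\<close>.
\<close>

definition L2_linear_operator ::
  "'a::euclidean_space set \<Rightarrow> ('a \<Rightarrow> real) set \<Rightarrow> (('a \<Rightarrow> real) \<Rightarrow> 'a \<Rightarrow> real) \<Rightarrow> bool" where
  "L2_linear_operator \<Omega> V C \<longleftrightarrow>
     (\<forall>u \<in> L2 \<Omega>. C u \<in> V) \<and>
     (\<forall>u \<in> L2 \<Omega>. \<forall>v \<in> L2 \<Omega>. (AE x in lebesgue_on \<Omega>. u x = v x) \<longrightarrow>
        (AE x in lebesgue_on \<Omega>. C u x = C v x)) \<and>
     (\<forall>u \<in> L2 \<Omega>. \<forall>v \<in> L2 \<Omega>. \<forall>a b. AE x in lebesgue_on \<Omega>.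
        C (\<lambda>y. a * u y + b * v y) x = a * C u x + b * C v x)"

definition L2_self_adjoint ::
  "'a::euclidean_space set \<Rightarrow> (('a \<Rightarrow> real) \<Rightarrow> 'a \<Rightarrow> real) \<Rightarrow> bool" where
  "L2_self_adjoint \<Omega> C \<longleftrightarrow>
     (\<forall>u \<in> L2 \<Omega>. \<forall>v \<in> L2 \<Omega>. L2_inner \<Omega> (C u) v = L2_inner \<Omega> u (C v))"

definition eigenvalues_on ::
  "'a::euclidean_space set \<Rightarrow> ('a \<Rightarrow> real) set \<Rightarrow> (('a \<Rightarrow> real) \<Rightarrow> 'a \<Rightarrow> real) \<Rightarrow> real set" where
  "eigenvalues_on \<Omega> V C =
     {l. \<exists>v\<in>V. \<not> (AE x in lebesgue_on \<Omega>. v x = 0) \<and>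
               (AE x in lebesgue_on \<Omega>. C v x = l * v x)}"

definition eig_min ::
  "'a::euclidean_space set \<Rightarrow> ('a \<Rightarrow> real) set \<Rightarrow> (('a \<Rightarrow> real) \<Rightarrow> 'a \<Rightarrow> real) \<Rightarrow> real" where
  "eig_min \<Omega> V C = Min (eigenvalues_on \<Omega> V C)"

definition eig_max ::
  "'a::euclidean_space set \<Rightarrow> ('a \<Rightarrow> real) set \<Rightarrow> (('a \<Rightarrow> real) \<Rightarrow> 'a \<Rightarrow> real) \<Rightarrow> real" where
  "eig_max \<Omega> V C = Max (eigenvalues_on \<Omega> V C)"

definition cond2 ::
  "'a::euclidean_space set \<Rightarrow> ('a \<Rightarrow> real) set \<Rightarrow> (('a \<Rightarrow> real) \<Rightarrow> 'a \<Rightarrow> real) \<Rightarrow> real" where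
  "cond2 \<Omega> V C = eig_max \<Omega> V C / eig_min \<Omega> V C"

definition neighbor_chain ::
  "'b set \<Rightarrow> ('b \<Rightarrow> 'b \<Rightarrow> bool) \<Rightarrow> 'b \<Rightarrow> 'b \<Rightarrow> nat \<Rightarrow> bool" where
  "neighbor_chain \<T> nb T T' N \<longleftrightarrow>
     (\<exists>S. S 0 = T \<and> S N = T' \<and> (\<forall>j\<le>N. S j \<in> \<T>) \<and> (\<forall>j\<in>{1..N}. nb (S (j - 1)) (S j)))"

definition neighbor_relation :: "'a set set \<Rightarrow> ('a set \<Rightarrow> 'a set \<Rightarrow> bool) \<Rightarrow> bool" where
  "neighbor_relation \<T> nb \<longleftrightarrow>
     (\<forall>T\<in>\<T>. \<forall>T'\<in>\<T>. nb T T' \<longrightarrow> T \<noteq> T' \<and> nb T' T \<and> T \<inter> T' \<noteq> {}) \<and>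
     (\<forall>T\<in>\<T>. \<forall>T'\<in>\<T>. \<exists>N. neighbor_chain \<T> nb T T' N)"

definition neighbor_distance :: "'a set set \<Rightarrow> ('a set \<Rightarrow> 'a set \<Rightarrow> nat) \<Rightarrow> bool" where
  "neighbor_distance \<T> \<delta> \<longleftrightarrow>
     (\<exists>nb. neighbor_relation \<T> nb \<and>
        (\<forall>T\<in>\<T>. \<forall>T'\<in>\<T>. \<delta> T T' = (LEAST N. neighbor_chain \<T> nb T T' N)))"

text \<open>
  The bounded existential quantifier expresses that the minimum of \<open>\<delta> T' T\<close> over \<open>T \<in> L\<close> is at most 1.
  For \<open>L = {}\<close> the condition holds trivially for linear \<open>C\<close>, since then \<open>C v\<close> has empty support.
\<close>

definition support_growth_le_1 ::
  "'a::euclidean_space set \<Rightarrow> 'a set set \<Rightarrow> ('a set \<Rightarrow> 'a set \<Rightarrow> nat) \<Rightarrow>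
    (('a \<Rightarrow> real) \<Rightarrow> 'a \<Rightarrow> real) \<Rightarrow> bool" where
  "support_growth_le_1 \<Omega> \<T> \<delta> C \<longleftrightarrow>
     (\<forall>v \<in> L2 \<Omega>. \<forall>L \<subseteq> \<T>. ess_support \<Omega> v \<subseteq> \<Union>L \<longrightarrow>
        (\<forall>T'\<in>\<T>. T' \<subseteq> ess_support \<Omega> (C v) \<longrightarrow> (\<exists>T\<in>L. \<delta> T' T \<le> 1)))"

definition ess_sup_on :: "'a::euclidean_space set \<Rightarrow> 'a set \<Rightarrow> ('a \<Rightarrow> real) \<Rightarrow> ereal" where
  "ess_sup_on \<Omega> T f = esssup (lebesgue_on (T \<inter> \<Omega>)) (\<lambda>x. ereal (f x))"

definition ess_inf_on :: "'a::euclidean_space set \<Rightarrow> 'a set \<Rightarrow> ('a \<Rightarrow> real) \<Rightarrow> ereal" where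
  "ess_inf_on \<Omega> T f = - ess_sup_on \<Omega> T (\<lambda>x. - f x)"

text \<open>
  The first inequality of the grading condition, together with integrability and positivity, makes
  \<open>\<rho>\<close> essentially bounded. Hence \<open>\<rho> u\<close> and \<open>\<rho> Q u\<close> lie in \<open>L\<^sup>2(\<Omega>)\<close> whenever \<open>u\<close> does, and no
  integral below takes its default value.
\<close>

definition weight_with_grading ::
  "'a::euclidean_space set \<Rightarrow> 'a set set \<Rightarrow> ('a set \<Rightarrow> 'a set \<Rightarrow> nat) \<Rightarrow> ('a \<Rightarrow> real) \<Rightarrow> real \<Rightarrow> bool"
where
  "weight_with_grading \<Omega> \<T> \<delta> \<rho> \<gamma> \<longleftrightarrow>
     integrable (lebesgue_on \<Omega>) \<rho> \<and> (AE x in lebesgue_on \<Omega>. 0 < \<rho> x) \<and> 1 \<le> \<gamma> \<and>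
     (\<forall>T\<in>\<T>. ess_sup_on \<Omega> T \<rho> \<le> ereal \<gamma> * ess_inf_on \<Omega> T \<rho>) \<and>
     (\<forall>T\<in>\<T>. \<forall>T'\<in>\<T>. \<delta> T T' = 1 \<longrightarrow>
        ess_sup_on \<Omega> T' \<rho> \<le> ereal \<gamma> * ess_sup_on \<Omega> T \<rho> \<and>
        ess_inf_on \<Omega> T' \<rho> \<le> ereal \<gamma> * ess_inf_on \<Omega> T \<rho>)"

text \<open>
  The set below is downward closed and contains its supremum, so the supremum is the largest number
  with the stated property (possibly \<open>\<infinity>\<close>). The constant \<open>c\<close> is chosen before \<open>\<rho>\<close>, i.e. it depends
  on \<open>\<rho>\<close> only through \<open>\<gamma>\<close>.
\<close>

definition worst_grading ::
  "'a::euclidean_space set \<Rightarrow> 'a set set \<Rightarrow> ('a set \<Rightarrow> 'a set \<Rightarrow> nat) \<Rightarrow>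
    (('a \<Rightarrow> real) \<Rightarrow> 'a \<Rightarrow> real) \<Rightarrow> ereal" where
  "worst_grading \<Omega> \<T> \<delta> Q =
     Sup {g :: ereal. \<forall>\<gamma>\<ge>1. ereal \<gamma> < g \<longrightarrow>
            (\<exists>c :: real. \<forall>\<rho>. weight_with_grading \<Omega> \<T> \<delta> \<rho> \<gamma> \<longrightarrow>
               (\<forall>u \<in> L2 \<Omega>. L2_norm \<Omega> (\<lambda>x. \<rho> x * Q u x) \<le> c * L2_norm \<Omega> (\<lambda>x. \<rho> x * u x)))}"

end

theory Submission
  imports Defs "HOL-Library.Function_Algebras" "HOL-Computational_Algebra.Polynomial"
begin

text \<open>
  Since \<open>C\<close> is self-adjoint with range in the finite element space, \<open>C Q u = C u\<close>; hence for a polynomial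
  \<open>p\<close> of degree \<open>m\<close> without constant term, \<open>p(C) Q u = p(C) u\<close> vanishes at distance more than \<open>m\<close> from the
  support of \<open>u\<close>. Choosing \<open>1 - p\<close> as the Chebyshev polynomial of the spectral interval, normalised at \<open>0\<close>,
  gives \<open>Q u\<close> up to an error \<open>2 q\<^sup>m \<parallel>u\<parallel>\<close>, i.e. exponential decay of \<open>Q u\<close> away from the support of \<open>u\<close>.
  A weight changes by at most a factor \<open>\<gamma>\<close> between neighbours, so cells whose weights differ by
  \<open>\<gamma>\<^sup>d\<close> have distance at least \<open>d\<close>. Decomposing \<open>u\<close> according to the order of magnitude of the weight, the
  weighted estimate reduces to Schur's test for a kernel dominated by \<open>2 \<gamma> (\<gamma> q)\<^sup>d\<^sup>-\<^sup>1\<close>.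
\<close>

section \<open>Self-adjoint operators on finite-dimensional subspaces\<close>

text \<open>The pieces of \<open>u\<close> are grouped by weight level rather than by cell. Row sums
  over cells would depend on how many cells lie at a given distance, hence on the mesh; levels are
  integers, so every row is dominated by a two-sided geometric series of ratio \<gamma> q. The
  Chebyshev estimate rests on one norm inequality, |c - A| \<le> r. With x = (c - A) / r one has T_m
  = U_m - x U_{m-1}, and the quadratic invariant of the U_m gives |T_m f| \<le> |f| as soon as |x|
  \<le> 1. The constant is a product: between levels the projection has norm at most 1 + 4 \<gamma>
  / (1 - \<gamma> q), which is at most 6 \<gamma> / (1 - \<gamma> q), and replacing the weight by
  its level costs one factor \<gamma> before and one after the projection. The axioms on
  \<open>ip\<close> are relativised to \<open>V\<close> because the L2 form is degenerate on the
  full function type.\<close>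

locale inner_subspace =
  fixes V :: "'v::real_vector set" and ip :: "'v \<Rightarrow> 'v \<Rightarrow> real"
  assumes subspace: "subspace V"
    and ip_add_left: "\<And>x y z. x \<in> V \<Longrightarrow> y \<in> V \<Longrightarrow> z \<in> V \<Longrightarrow> ip (x + y) z = ip x z + ip y z"
    and ip_scale_left: "\<And>a x y. x \<in> V \<Longrightarrow> y \<in> V \<Longrightarrow> ip (a *\<^sub>R x) y = a * ip x y"
    and ip_commute: "\<And>x y. x \<in> V \<Longrightarrow> y \<in> V \<Longrightarrow> ip x y = ip y x"
    and ip_pos: "\<And>x. x \<in> V \<Longrightarrow> x \<noteq> 0 \<Longrightarrow> 0 < ip x x"
    and finite_dim: "\<exists>F. finite F \<and> V \<subseteq> span F"
begin

lemma V_closed [simp]: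
  "0 \<in> V" "x \<in> V \<Longrightarrow> y \<in> V \<Longrightarrow> x + y \<in> V" "x \<in> V \<Longrightarrow> y \<in> V \<Longrightarrow> x - y \<in> V"
  "x \<in> V \<Longrightarrow> a *\<^sub>R x \<in> V" "(\<And>i. i \<in> I \<Longrightarrow> f i \<in> V) \<Longrightarrow> (\<Sum>i\<in>I. f i) \<in> V"
  using subspace by (auto simp: subspace_0 subspace_add subspace_diff subspace_scale subspace_sum)

lemma ip_add_right: "x \<in> V \<Longrightarrow> y \<in> V \<Longrightarrow> z \<in> V \<Longrightarrow> ip z (x + y) = ip z x + ip z y"
  by (simp add: ip_commute[of z] ip_add_left)

lemma ip_scale_right: "x \<in> V \<Longrightarrow> y \<in> V \<Longrightarrow> ip y (a *\<^sub>R x) = a * ip y x"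
  by (simp add: ip_commute[of y] ip_scale_left)

lemma ip_diff_left: "x \<in> V \<Longrightarrow> y \<in> V \<Longrightarrow> z \<in> V \<Longrightarrow> ip (x - y) z = ip x z - ip y z"
  using ip_add_left[of x "(-1) *\<^sub>R y" z] ip_scale_left[of y z "-1"] V_closed(4)[of y "-1"] by simp

lemma ip_diff_right: "x \<in> V \<Longrightarrow> y \<in> V \<Longrightarrow> z \<in> V \<Longrightarrow> ip z (x - y) = ip z x - ip z y"
  by (simp add: ip_commute[of z] ip_diff_left)

lemma ip_0_left [simp]: "x \<in> V \<Longrightarrow> ip 0 x = 0"
  using ip_scale_left[of x x 0] by simp

lemma ip_0_right [simp]: "x \<in> V \<Longrightarrow> ip x 0 = 0"
  by (simp add: ip_commute[of x])

lemma ip_nonneg [simp]: "x \<in> V \<Longrightarrow> 0 \<le> ip x x"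
  using ip_pos[of x] by (cases "x = 0") auto

lemma ip_self_eq_0: "x \<in> V \<Longrightarrow> ip x x = 0 \<longleftrightarrow> x = 0"
  using ip_pos[of x] by (cases "x = 0") auto

lemma ip_sum_left:
  "(\<And>i. i \<in> I \<Longrightarrow> f i \<in> V) \<Longrightarrow> y \<in> V \<Longrightarrow> ip (\<Sum>i\<in>I. f i) y = (\<Sum>i\<in>I. ip (f i) y)"
  by (induction I rule: infinite_finite_induct) (auto simp: ip_add_left)

lemma ip_sum_right:
  "(\<And>i. i \<in> I \<Longrightarrow> f i \<in> V) \<Longrightarrow> y \<in> V \<Longrightarrow> ip y (\<Sum>i\<in>I. f i) = (\<Sum>i\<in>I. ip y (f i))"
  by (induction I rule: infinite_finite_induct) (auto simp: ip_add_right)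

lemma ip_linear_combination:
  assumes "\<And>i. i \<in> I \<Longrightarrow> f i \<in> V"
  shows "ip (\<Sum>i\<in>I. x i *\<^sub>R f i) (\<Sum>i\<in>I. x i *\<^sub>R f i) = (\<Sum>i\<in>I. \<Sum>j\<in>I. x i * (x j * ip (f i) (f j)))"
proof -
  have V: "x i *\<^sub>R f i \<in> V" if "i \<in> I" for i using assms[OF that] by (rule V_closed)
  have "ip (\<Sum>i\<in>I. x i *\<^sub>R f i) (\<Sum>i\<in>I. x i *\<^sub>R f i) = (\<Sum>i\<in>I. ip (x i *\<^sub>R f i) (\<Sum>j\<in>I. x j *\<^sub>R f j))"
    by (intro ip_sum_left V_closed V)
  also have "\<dots> = (\<Sum>i\<in>I. \<Sum>j\<in>I. ip (x i *\<^sub>R f i) (x j *\<^sub>R f j))"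
    by (intro sum.cong refl ip_sum_right V)
  also have "\<dots> = (\<Sum>i\<in>I. \<Sum>j\<in>I. x i * (x j * ip (f i) (f j)))"
    using assms by (intro sum.cong refl) (simp add: ip_scale_left ip_scale_right)
  finally show ?thesis .
qed

lemmas ip_simps = ip_add_left ip_add_right ip_diff_left ip_diff_right ip_scale_left ip_scale_right


text \<open>Left unnormalised so that it covers orthonormal systems as well as families of
  eigenvectors.\<close>

definition orthogonal_set :: "'v set \<Rightarrow> bool" where
  "orthogonal_set E \<longleftrightarrow> E \<subseteq> V \<and> 0 \<notin> E \<and> pairwise (\<lambda>e e'. ip e e' = 0) E"

lemma orthogonal_set_independent:
  assumes "orthogonal_set E" shows "independent E"
proof
  have E: "E \<subseteq> V" "0 \<notin> E" and orth: "\<And>e e'. e \<in> E \<Longrightarrow> e' \<in> E \<Longrightarrow> e \<noteq> e' \<Longrightarrow> ip e e' = 0"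
    using assms by (auto simp: orthogonal_set_def pairwise_def)
  assume "dependent E"
  then obtain t u w where t: "finite t" "t \<subseteq> E" "(\<Sum>v\<in>t. u v *\<^sub>R v) = 0" "w \<in> t" "u w \<noteq> 0"
    unfolding dependent_explicit by blast
  have w: "w \<in> V" "w \<noteq> 0" using t E by auto
  have "0 = ip (\<Sum>v\<in>t. u v *\<^sub>R v) w" using t(3) w by simp
  also have "\<dots> = (\<Sum>v\<in>t. u v * ip v w)"
    using t(2) E w by (subst ip_sum_left) (auto simp: ip_scale_left subset_iff intro!: sum.cong)
  also have "\<dots> = (\<Sum>v\<in>t. if v = w then u v * ip v w else 0)"
    using t(2,4) orth by (intro sum.cong) auto
  also have "\<dots> = u w * ip w w" using t(1,4) by simp
  finally show False using t(5) ip_pos[OF w] by simp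
qed

text \<open>The bound is uniform in \<open>E\<close>. It yields both a largest orthonormal system
  and the finiteness of the spectrum.\<close>

lemma orthogonal_card_bound:
  obtains n where "\<And>E. orthogonal_set E \<Longrightarrow> finite E \<and> card E \<le> n"
proof -
  obtain F where F: "finite F" "V \<subseteq> span F" using finite_dim by blast
  have "finite E \<and> card E \<le> card F" if "orthogonal_set E" for E
    using independent_span_bound[OF F(1) orthogonal_set_independent[OF that]] that F(2)
    by (auto simp: orthogonal_set_def)
  then show ?thesis using that by blast
qed

text \<open>Take an orthonormal system of largest cardinality: if the expansion failed for some
  \<open>v\<close>, the normalised residual could be added to the system.\<close>

lemma orthonormal_basis:
  obtains E where "finite E" "E \<subseteq> V"
    "\<And>e e'. e \<in> E \<Longrightarrow> e' \<in> E \<Longrightarrow> ip e e' = (if e = e' then 1 else 0)"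
    "\<And>v. v \<in> V \<Longrightarrow> v = (\<Sum>e\<in>E. ip v e *\<^sub>R e)"
proof -
  define P where "P E \<longleftrightarrow> E \<subseteq> V \<and> (\<forall>e\<in>E. \<forall>e'\<in>E. ip e e' = (if e = e' then 1 else 0))" for E
  obtain n where n: "\<And>E. orthogonal_set E \<Longrightarrow> finite E \<and> card E \<le> n"
    using orthogonal_card_bound by blast
  have PE: "finite E \<and> card E \<le> n" if "P E" for E
    using that unfolding P_def by (intro n) (force simp: orthogonal_set_def pairwise_def)
  have "P {}" by (simp add: P_def)
  then obtain E where E: "P E" and max: "\<And>E'. P E' \<Longrightarrow> card E' \<le> card E"
    using ex_has_greatest_nat[of P "{}" card "Suc n"] PE by (auto simp: less_Suc_eq_le)
  have fin: "finite E" using PE E by blast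
  have EV: "e \<in> V" if "e \<in> E" for e using E that by (auto simp: P_def)
  have "v = (\<Sum>e\<in>E. ip v e *\<^sub>R e)" if v: "v \<in> V" for v
  proof (rule ccontr)
    define w where "w = v - (\<Sum>e\<in>E. ip v e *\<^sub>R e)"
    assume "v \<noteq> (\<Sum>e\<in>E. ip v e *\<^sub>R e)"
    then have w0: "w \<noteq> 0" by (simp add: w_def)
    have w: "w \<in> V" unfolding w_def using v EV by (intro V_closed)
    have orth: "ip w e = 0" if e: "e \<in> E" for e
    proof -
      have "ip (\<Sum>e\<in>E. ip v e *\<^sub>R e) e = (\<Sum>e'\<in>E. ip v e' * ip e' e)"
        using EV e by (subst ip_sum_left) (auto simp: ip_scale_left)
      also have "\<dots> = (\<Sum>e'\<in>E. if e' = e then ip v e' else 0)"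
        using E e by (intro sum.cong) (auto simp: P_def)
      finally have "ip (\<Sum>e\<in>E. ip v e *\<^sub>R e) e = ip v e" using e fin by simp
      moreover have "(\<Sum>e\<in>E. ip v e *\<^sub>R e) \<in> V" using EV by (intro V_closed)
      ultimately show ?thesis using EV[OF e] v by (simp add: w_def ip_diff_left)
    qed
    define d where "d = (1 / sqrt (ip w w)) *\<^sub>R w"
    have d: "d \<in> V" "ip d d = 1"
      using w ip_pos[OF w w0] by (auto simp: d_def ip_scale_left ip_scale_right field_simps)
    have d': "ip d e = 0" "ip e d = 0" if "e \<in> E" for e
      using w orth[OF that] EV[OF that] ip_commute[of w e]
      by (auto simp: d_def ip_scale_left ip_scale_right)
    have "d \<notin> E" using d d' by force
    moreover have "P (insert d E)" using E d d' by (auto simp: P_def)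
    ultimately show False using max[of "insert d E"] fin by simp
  qed
  then show ?thesis using E by (intro that[of E] fin) (auto simp only: P_def)
qed

end

section \<open>Self-adjoint operators: finite spectrum and extremal eigenvalue\<close>

locale self_adjoint_operator = inner_subspace V ip for V :: "'v::real_vector set" and ip +
  fixes A :: "'v \<Rightarrow> 'v"
  assumes A_closed [simp]: "\<And>x. x \<in> V \<Longrightarrow> A x \<in> V"
    and A_add: "\<And>x y. x \<in> V \<Longrightarrow> y \<in> V \<Longrightarrow> A (x + y) = A x + A y"
    and A_scale: "\<And>a x. x \<in> V \<Longrightarrow> A (a *\<^sub>R x) = a *\<^sub>R A x"
    and A_adj: "\<And>x y. x \<in> V \<Longrightarrow> y \<in> V \<Longrightarrow> ip (A x) y = ip x (A y)"
begin

lemma A_0 [simp]: "A 0 = 0"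
  using A_scale[of 0 0] by simp

lemma A_diff: "x \<in> V \<Longrightarrow> y \<in> V \<Longrightarrow> A (x - y) = A x - A y"
  using A_add[of "x - y" y] by (simp add: algebra_simps)

lemma A_sum: "(\<And>i. i \<in> I \<Longrightarrow> f i \<in> V) \<Longrightarrow> A (\<Sum>i\<in>I. f i) = (\<Sum>i\<in>I. A (f i))"
  by (induction I rule: infinite_finite_induct) (auto simp: A_add)

definition eigenvalues :: "real set" where
  "eigenvalues = {l. \<exists>v\<in>V. v \<noteq> 0 \<and> A v = l *\<^sub>R v}"

text \<open>Eigenvectors to distinct eigenvalues are orthogonal, so there are boundedly many.
  Finiteness gives meaning to the \<open>Min\<close> and \<open>Max\<close> that define the
  condition number.\<close>

lemma finite_eigenvalues: "finite eigenvalues"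
proof -
  obtain n where n: "\<And>E. orthogonal_set E \<Longrightarrow> finite E \<and> card E \<le> n"
    using orthogonal_card_bound by blast
  have "\<forall>l\<in>eigenvalues. \<exists>v. v \<in> V \<and> v \<noteq> 0 \<and> A v = l *\<^sub>R v"
    by (auto simp: eigenvalues_def)
  then obtain w where w: "\<forall>l\<in>eigenvalues. w l \<in> V \<and> w l \<noteq> 0 \<and> A (w l) = l *\<^sub>R w l"
    using bchoice by metis
  have inj: "inj_on w eigenvalues"
    by (rule inj_onI) (metis w scaleR_cancel_right)
  have "ip (w l) (w m) = 0" if "l \<in> eigenvalues" "m \<in> eigenvalues" "l \<noteq> m" for l m
  proof -
    have "l * ip (w l) (w m) = m * ip (w l) (w m)"
      using A_adj[of "w l" "w m"] w that
      by (simp add: ip_scale_left ip_scale_right)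
    then show ?thesis using that by simp
  qed
  then have "orthogonal_set (w ` eigenvalues)"
    using w unfolding orthogonal_set_def pairwise_def by fastforce
  then have "finite (w ` eigenvalues)" using n by blast
  then show ?thesis using inj by (rule finite_imageD)
qed

text \<open>\<open>V\<close> carries no topology, so compactness of the unit sphere is taken from
  coordinates with respect to an orthonormal basis.\<close>

lemma norm_attaining_vector:
  assumes "V \<noteq> {0}"
  obtains w where "w \<in> V" "ip w w = 1"
    "\<And>v. v \<in> V \<Longrightarrow> ip (A v) (A v) \<le> ip (A w) (A w) * ip v v"
proof -
  obtain E where E: "finite E" "E \<subseteq> V"
    "\<And>e e'. e \<in> E \<Longrightarrow> e' \<in> E \<Longrightarrow> ip e e' = (if e = e' then 1 else 0)"
    "\<And>v. v \<in> V \<Longrightarrow> v = (\<Sum>e\<in>E. ip v e *\<^sub>R e)"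
    using orthonormal_basis by metis
  define vec where "vec x = (\<Sum>e\<in>E. x e *\<^sub>R e)" for x :: "'v \<Rightarrow> real"
  have vec_V: "vec x \<in> V" for x unfolding vec_def using E(2) by (intro V_closed) auto
  have ip_vec: "ip (vec x) (vec x) = (\<Sum>e\<in>E. (x e)\<^sup>2)" for x
  proof -
    have "ip (vec x) (vec x) = (\<Sum>e\<in>E. \<Sum>e'\<in>E. x e * (x e' * ip e e'))"
      unfolding vec_def using E(2) by (intro ip_linear_combination) auto
    also have "\<dots> = (\<Sum>e\<in>E. \<Sum>e'\<in>E. if e = e' then (x e)\<^sup>2 else 0)"
      using E(3) by (intro sum.cong) (auto simp: power2_eq_square)
    finally show ?thesis using E(1) by simp
  qed
  define G where "G x = ip (A (vec x)) (A (vec x))" for x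
  have G: "G x = (\<Sum>e\<in>E. \<Sum>e'\<in>E. x e * (x e' * ip (A e) (A e')))" for x
  proof -
    have "A (vec x) = (\<Sum>e\<in>E. x e *\<^sub>R A e)"
      unfolding vec_def using E(2) by (subst A_sum) (auto simp: A_scale subset_iff intro!: sum.cong)
    then show ?thesis unfolding G_def
      using E(2) ip_linear_combination[of E A x] by (auto simp: subset_iff)
  qed
  \<comment> \<open>The unit sphere of the coordinate space, written with functions on the whole
    type: coordinates outside \<open>E\<close> are pinned to 0, so the surrounding box is a product
    of compact sets and Tychonoff applies.\<close>
  define S where "S = PiE UNIV (\<lambda>e. if e \<in> E then {-1..1} else {0::real}) \<inter> {x. (\<Sum>e\<in>E. (x e)\<^sup>2) = 1}"
  have "compact (PiE UNIV (\<lambda>e. if e \<in> E then {-1..1} else {0::real}))"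
    using compactin_PiE[of "\<lambda>_. euclidean" UNIV "\<lambda>e. if e \<in> E then {-1..1} else {0::real}"]
    by (auto simp: euclidean_product_topology)
  moreover have "closed {x. (\<Sum>e\<in>E. (x e)\<^sup>2) = (1::real)}"
    by (intro closed_Collect_eq continuous_intros) auto
  ultimately have "compact S" unfolding S_def by (rule compact_Int_closed)
  obtain u where u: "u \<in> V" "u \<noteq> 0" using assms V_closed(1) by blast
  have norm1: "\<exists>x\<in>S. v = sqrt (ip v v) *\<^sub>R vec x" if v: "v \<in> V" "v \<noteq> 0" for v
  proof
    define x where "x e = (if e \<in> E then ip v e / sqrt (ip v v) else 0)" for e
    have p: "sqrt (ip v v) > 0" using ip_pos[OF v] by simp
    have "sqrt (ip v v) *\<^sub>R vec x = (\<Sum>e\<in>E. ip v e *\<^sub>R e)"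
      unfolding vec_def x_def scaleR_sum_right using p by (intro sum.cong) auto
    then show *: "v = sqrt (ip v v) *\<^sub>R vec x" using E(4)[OF v(1)] by simp
    have "ip v v = (sqrt (ip v v))\<^sup>2 * ip (vec x) (vec x)"
      by (subst (1 2) *) (simp add: ip_scale_left ip_scale_right vec_V power2_eq_square del: real_sqrt_mult_self)
    then have one: "(\<Sum>e\<in>E. (x e)\<^sup>2) = 1" using p v(1) by (simp add: ip_vec)
    have "\<bar>x e\<bar> \<le> 1" if "e \<in> E" for e
      using member_le_sum[of e E "\<lambda>e. (x e)\<^sup>2"] that E(1) one by (simp add: abs_square_le_1)
    then have "x e \<in> {-1..1}" if "e \<in> E" for e using that by (simp add: abs_le_iff minus_le_iff)
    moreover have "x e = 0" if "e \<notin> E" for e using that by (simp add: x_def)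
    ultimately show "x \<in> S" using one by (auto simp: S_def)
  qed
  have "S \<noteq> {}" using norm1[OF u] by auto
  \<comment> \<open>By \<open>G\<close> the objective is a quadratic polynomial in finitely many
    coordinates.\<close>
  moreover have "continuous_on S G"
    unfolding G by (intro continuous_intros continuous_on_product_then_coordinatewise[OF continuous_on_id])
  ultimately obtain x where x: "x \<in> S" "\<And>y. y \<in> S \<Longrightarrow> G y \<le> G x"
    using continuous_attains_sup[OF \<open>compact S\<close>] by blast
  show ?thesis
  proof
    show "vec x \<in> V" by (rule vec_V)
    show "ip (vec x) (vec x) = 1" using x(1) by (simp add: ip_vec S_def)
    fix v assume v: "v \<in> V"
    show "ip (A v) (A v) \<le> ip (A (vec x)) (A (vec x)) * ip v v"
    proof (cases "v = 0")
      case False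
      obtain y where y: "y \<in> S" "v = sqrt (ip v v) *\<^sub>R vec y" using norm1[OF v False] by blast
      have "A v = sqrt (ip v v) *\<^sub>R A (vec y)"
        by (subst y(2)) (rule A_scale[OF vec_V])
      then have "ip (A v) (A v) = ip v v * G y"
        using v by (simp add: G_def ip_scale_left ip_scale_right vec_V)
      then show ?thesis using x(2)[OF y(1)] v by (simp add: G_def mult.commute mult_left_mono)
    qed auto
  qed
qed

text \<open>A maximiser \<open>w\<close> of |A v| on the unit sphere is an eigenvector of A^2; a
  square root of that eigenvalue, with one of the two signs, is an eigenvalue of A.\<close>

lemma eigenvalue_of_maximal_modulus:
  assumes "V \<noteq> {0}"
  obtains l where "l \<in> eigenvalues" "\<And>v. v \<in> V \<Longrightarrow> ip (A v) (A v) \<le> l\<^sup>2 * ip v v"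
proof -
  obtain w where w: "w \<in> V" "ip w w = 1"
    and max: "\<And>v. v \<in> V \<Longrightarrow> ip (A v) (A v) \<le> ip (A w) (A w) * ip v v"
    using norm_attaining_vector[OF assms] by blast
  define M where "M = ip (A w) (A w)"
  \<comment> \<open>The defect in the Euler-Lagrange equation A^2 w = M w. Varying \<open>w\<close>
    in the direction \<open>d\<close> itself makes the first-order term -2 t |d|^2, so maximality
    forces \<open>d = 0\<close>.\<close>
  define d where "d = A (A w) - M *\<^sub>R w"
  have d: "d \<in> V" using w by (simp add: d_def)
  have "0 \<le> t * (2 * - ip d d) + t\<^sup>2 * (M * ip d d - ip (A d) (A d))" for t
  proof -
    have "0 \<le> M * ip (w + t *\<^sub>R d) (w + t *\<^sub>R d) - ip (A (w + t *\<^sub>R d)) (A (w + t *\<^sub>R d))"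
      using max[of "w + t *\<^sub>R d"] w d by (simp add: M_def)
    also have "\<dots> = t * (2 * - ip d d) + t\<^sup>2 * (M * ip d d - ip (A d) (A d))"
    proof -
      have 1: "ip (A d) (A w) = ip d d + M * ip d w"
        using A_adj[of "A w" d] ip_commute[of w d] ip_commute[of "A w" "A d"] ip_diff_left[of "A (A w)" "M *\<^sub>R w" d] w d
        by (simp add: d_def[symmetric] ip_scale_left)
      show ?thesis using w d ip_commute[of w d] ip_commute[of "A w" "A d"]
        by (simp add: A_add A_scale ip_simps M_def[symmetric] power2_eq_square 1) (simp add: algebra_simps)
    qed
    finally show ?thesis .
  qed
  note quad = this
  have "ip d d = 0"
  proof (rule ccontr)
    assume "ip d d \<noteq> 0"
    then have p: "ip d d > 0" using ip_nonneg[OF d] by linarith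
    define N where "N = \<bar>M * ip d d - ip (A d) (A d)\<bar> + 1"
    \<comment> \<open>With this \<open>t\<close> the quadratic term t^2 N equals t |d|^2, half the
      modulus of the linear term, so the sum is negative.\<close>
    define t where "t = ip d d / N"
    have N: "N > 0" "M * ip d d - ip (A d) (A d) \<le> N" by (auto simp: N_def)
    have "0 \<le> t * (2 * - ip d d) + t\<^sup>2 * N"
      using quad[of t] N(2) mult_left_mono[OF N(2), of "t\<^sup>2"] by simp
    also have "\<dots> = - (t * ip d d)" using N by (simp add: t_def power2_eq_square field_simps)
    also have "\<dots> < 0" using p N by (simp add: t_def)
    finally show False by simp
  qed
  then have AAw: "A (A w) = M *\<^sub>R w" using ip_self_eq_0[OF d] by (simp add: d_def)
  define m where "m = sqrt M"
  have M0: "M \<ge> 0" using w by (simp add: M_def)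
  then have mm: "m * m = M" by (simp add: m_def)
  \<comment> \<open>A^2 w = m^2 w reads (A - m) (A + m) w = 0. Either z = (A + m) w is an
    eigenvector to m, or it vanishes and \<open>w\<close> is an eigenvector to -m.\<close>
  define z where "z = A w + m *\<^sub>R w"
  have z: "z \<in> V" "A z = m *\<^sub>R z"
    using w AAw by (auto simp: z_def A_add A_scale mm scaleR_add_right add.commute)
  have "\<exists>l\<in>eigenvalues. l\<^sup>2 = M"
  proof (cases "z = 0")
    case True
    then have "A w = (- m) *\<^sub>R w" by (simp add: z_def eq_neg_iff_add_eq_0)
    moreover have "w \<noteq> 0" using w(2) w(1) by auto
    ultimately have "- m \<in> eigenvalues" using w(1) by (auto simp: eigenvalues_def)
    then show ?thesis using mm by (intro bexI[of _ "- m"]) (auto simp: power2_eq_square)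
  next
    case False
    then show ?thesis using z mm by (intro bexI[of _ m]) (auto simp: eigenvalues_def power2_eq_square)
  qed
  then show ?thesis using that max by (auto simp: M_def)
qed

section \<open>Chebyshev approximation on the spectral interval\<close>

lemma self_adjoint_shift:
  "self_adjoint_operator V ip (\<lambda>x. c *\<^sub>R x - A x)"
  by unfold_locales
    (auto simp: A_add A_scale A_adj ip_simps algebra_simps)

text \<open>The eigenvalues of c - A are the numbers c - l, and the one of largest modulus is the
  operator norm. This carries all the spectral information used by the Chebyshev argument.\<close>

lemma shift_norm_bound:
  assumes "eigenvalues \<subseteq> {c - r..c + r}" "v \<in> V"
  shows "ip (c *\<^sub>R v - A v) (c *\<^sub>R v - A v) \<le> r\<^sup>2 * ip v v"
proof (cases "V = {0}")
  case False
  interpret B: self_adjoint_operator V ip "\<lambda>x. c *\<^sub>R x - A x" by (rule self_adjoint_shift)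
  obtain l where l: "l \<in> B.eigenvalues"
    "\<And>v. v \<in> V \<Longrightarrow> ip (c *\<^sub>R v - A v) (c *\<^sub>R v - A v) \<le> l\<^sup>2 * ip v v"
    using B.eigenvalue_of_maximal_modulus[OF False] by blast
  then obtain u where u: "u \<in> V" "u \<noteq> 0" "c *\<^sub>R u - A u = l *\<^sub>R u" by (auto simp: B.eigenvalues_def)
  then have "A u = (c - l) *\<^sub>R u" by (simp add: algebra_simps)
  then have "c - l \<in> eigenvalues" using u by (auto simp: eigenvalues_def)
  then have "\<bar>l\<bar> \<le> \<bar>r\<bar>" using assms(1) by (auto simp: subset_iff abs_le_iff)
  then have "l\<^sup>2 \<le> r\<^sup>2" by (simp add: abs_le_square_iff)
  then show ?thesis using l(2)[OF assms(2)] mult_right_mono[of "l\<^sup>2" "r\<^sup>2" "ip v v"] assms(2) by simp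
qed (use assms in auto)

lemma eigenvalues_nonempty: "V \<noteq> {0} \<Longrightarrow> eigenvalues \<noteq> {}"
  using eigenvalue_of_maximal_modulus by blast

text \<open>
  With \<open>B = c - A\<close>, \<open>z\<close> and \<open>z'\<close> are consecutive (rescaled) Chebyshev polynomials of the second kind
  \<open>r\<^sup>m\<^sup>-\<^sup>1 U\<^sub>m\<^sub>-\<^sub>1(B / r) f\<close>, \<open>\<sigma>\<close> and \<open>\<sigma>'\<close> are their values at \<open>A = 0\<close>, and the quadratic invariant is
  \<open>U\<^sub>m\<^sup>2 - 2 x U\<^sub>m U\<^sub>m\<^sub>-\<^sub>1 + U\<^sub>m\<^sub>-\<^sub>1\<^sup>2 = 1\<close>.
\<close>

lemma chebyshev_sequence:
  fixes c r s t :: real and N :: "nat \<Rightarrow> 'v set"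
  assumes f: "f \<in> V" and st: "s + t = 2 * c" "s * t = r\<^sup>2"
    and N: "\<And>m. subspace (N m)" "\<And>m. N m \<subseteq> V" "\<And>m. N m \<subseteq> N (Suc m)"
      "\<And>m x. x \<in> N m \<Longrightarrow> A x \<in> N (Suc m)" "A f \<in> N 1"
  shows "\<exists>z z' w w' \<sigma> \<sigma>'. z \<in> V \<and> z' \<in> V \<and> w \<in> N (m - 1) \<and> w' \<in> N m \<and>
    z = \<sigma> *\<^sub>R f - w \<and> z' = \<sigma>' *\<^sub>R f - w' \<and> \<sigma>' - s * \<sigma> = t ^ m \<and> \<sigma>' - t * \<sigma> = s ^ m \<and>
    ip z' z' - 2 * ip z' (c *\<^sub>R z - A z) + r\<^sup>2 * ip z z = r ^ (2 * m) * ip f f"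
proof (induction m)
  case 0
  show ?case
    \<comment> \<open>U_{-1} = 0 and U_0 = 1. The index \<open>m - 1\<close> is 0 here by truncated
      subtraction, which is harmless since \<open>w = 0\<close>.\<close>
    by (rule exI[of _ 0], rule exI[of _ f], rule exI[of _ 0], rule exI[of _ 0], rule exI[of _ 0],
        rule exI[of _ 1]) (use N(1) f in \<open>auto simp: subspace_0\<close>)
next
  case (Suc m)
  then obtain z z' w w' \<sigma> \<sigma>' where V: "z \<in> V" "z' \<in> V" and w: "w \<in> N (m - 1)" "w' \<in> N m"
    and z: "z = \<sigma> *\<^sub>R f - w" "z' = \<sigma>' *\<^sub>R f - w'"
    and \<sigma>: "\<sigma>' - s * \<sigma> = t ^ m" "\<sigma>' - t * \<sigma> = s ^ m"
    and norm: "ip z' z' - 2 * ip z' (c *\<^sub>R z - A z) + r\<^sup>2 * ip z z = r ^ (2 * m) * ip f f"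
    by blast
  have mono: "N i \<subseteq> N j" if "i \<le> j" for i j
    using that N(3) by (rule lift_Suc_mono_le[rotated])
  have wV: "w \<in> V" "w' \<in> V" using w N(2) by blast+
  \<comment> \<open>The recurrence z'' = 2 (c - A) z' - r^2 z, solved for the part of z'' that is
    not a multiple of \<open>f\<close>. The vector \<open>f\<close> enters it only through
    \<open>A f\<close>, which lies in \<open>N 1\<close>; the coefficient of \<open>f\<close>
    follows the same recurrence with A = 0.\<close>
  define w'' where "w'' = (2 * c) *\<^sub>R w' + (2 * \<sigma>') *\<^sub>R A f - 2 *\<^sub>R A w' - r\<^sup>2 *\<^sub>R w"
  define z'' where "z'' = 2 *\<^sub>R (c *\<^sub>R z' - A z') - r\<^sup>2 *\<^sub>R z"
  have z''V: "z'' \<in> V" using V by (simp add: z''_def)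
  have "w \<in> N (Suc m)" "w' \<in> N (Suc m)" "A f \<in> N (Suc m)" "A w' \<in> N (Suc m)"
    using w N(4)[OF w(2)] N(5) subsetD[OF mono[of "m - 1" "Suc m"]] subsetD[OF mono[of m "Suc m"]]
      subsetD[OF mono[of 1 "Suc m"]] by simp_all
  then have w'': "w'' \<in> N (Suc m)"
    unfolding w''_def by (intro subspace_diff[OF N(1)] subspace_add[OF N(1)] subspace_scale[OF N(1)])
  have z'': "z'' = (2 * c * \<sigma>' - r\<^sup>2 * \<sigma>) *\<^sub>R f - w''"
    using f wV by (simp add: z''_def w''_def z A_diff A_scale algebra_simps scaleR_add_left[symmetric])
  have "ip z' (c *\<^sub>R z - A z) = ip (c *\<^sub>R z' - A z') z"
    using V by (simp add: ip_simps A_adj)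
  moreover have "ip z'' z'' - 2 * ip z'' (c *\<^sub>R z' - A z') =
      r\<^sup>2 * (r\<^sup>2 * ip z z - 2 * ip (c *\<^sub>R z' - A z') z)"
  proof -
    define y where "y = c *\<^sub>R z' - A z'"
    have "y \<in> V" using V by (simp add: y_def)
    then show ?thesis unfolding z''_def y_def[symmetric] using V
      by (simp add: ip_simps ip_commute[of z y]) (simp add: algebra_simps)
  qed
  ultimately have "ip z'' z'' - 2 * ip z'' (c *\<^sub>R z' - A z') + r\<^sup>2 * ip z' z' =
      r\<^sup>2 * (ip z' z' - 2 * ip z' (c *\<^sub>R z - A z) + r\<^sup>2 * ip z z)"
    by (simp add: algebra_simps)
  also have "\<dots> = r ^ (2 * Suc m) * ip f f" unfolding norm by (simp add: power2_eq_square)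
  finally have norm'': "ip z'' z'' - 2 * ip z'' (c *\<^sub>R z' - A z') + r\<^sup>2 * ip z' z' =
      r ^ (2 * Suc m) * ip f f" .
  \<comment> \<open>\<open>s\<close> and \<open>t\<close> are the roots of X^2 - 2 c X + r^2, the
    characteristic polynomial of the scalar recurrence. Subtracting one root times the previous term
    leaves a geometric sequence in the other.\<close>
  have "2 * c * \<sigma>' - r\<^sup>2 * \<sigma> - s * \<sigma>' = t * (\<sigma>' - s * \<sigma>)"
    "2 * c * \<sigma>' - r\<^sup>2 * \<sigma> - t * \<sigma>' = s * (\<sigma>' - t * \<sigma>)"
    unfolding st[symmetric] by (simp_all add: algebra_simps)
  then have "2 * c * \<sigma>' - r\<^sup>2 * \<sigma> - s * \<sigma>' = t ^ Suc m" "2 * c * \<sigma>' - r\<^sup>2 * \<sigma> - t * \<sigma>' = s ^ Suc m"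
    using \<sigma> by simp_all
  with V(2) z''V w(2) w'' z(2) z'' norm'' show ?case
    by (intro exI[of _ z'] exI[of _ z''] exI[of _ w'] exI[of _ w''] exI[of _ \<sigma>']
        exI[of _ "2 * c * \<sigma>' - r\<^sup>2 * \<sigma>"]) simp
qed

text \<open>The filtration \<open>N\<close> stands for the vectors p(A) f with p(0) = 0 and degree
  at most m, but only its closure properties are recorded, so that in the application it can consist
  of functions with controlled support. The vector \<open>f\<close> itself need not lie in any
  \<open>N m\<close>.\<close>

lemma chebyshev_approximation:
  fixes a b q :: real and N :: "nat \<Rightarrow> 'v set"
  assumes f: "f \<in> V" and ab: "0 < a" "a \<le> b" and eig: "eigenvalues \<subseteq> {a..b}"
    and N: "\<And>m. subspace (N m)" "\<And>m. N m \<subseteq> V" "\<And>m. N m \<subseteq> N (Suc m)"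
      "\<And>m x. x \<in> N m \<Longrightarrow> A x \<in> N (Suc m)" "A f \<in> N 1"
    and q: "q = (sqrt b - sqrt a) / (sqrt b + sqrt a)"
  obtains y where "y \<in> N m" "ip (f - y) (f - y) \<le> (2 * q ^ m)\<^sup>2 * ip f f"
proof (cases m)
  \<comment> \<open>Since \<open>A f\<close> is only known to lie in \<open>N 1\<close>, degree 0
    leaves the choice y = 0; the factor 2 makes the bound true.\<close>
  case 0
  then show ?thesis
    using that[of 0] N(1)[of 0] f by (simp add: subspace_0)
next
  case (Suc k)
  \<comment> \<open>Midpoint and radius of {a..b}, and the characteristic roots for them: s + t = a
    + b and s t = ((b - a) / 2)^2. In terms of q, r = q s and t = q^2 s.\<close>
  define c r s t where "c = (a + b) / 2" and "r = (b - a) / 2"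
    and "s = (sqrt b + sqrt a)\<^sup>2 / 2" and "t = (sqrt b - sqrt a)\<^sup>2 / 2"
  have sq: "sqrt a * sqrt a = a" "sqrt b * sqrt b = b" "sqrt a > 0" "sqrt b > 0" using ab by auto
  have s0: "s > 0" using add_pos_pos[OF sq(4,3)] unfolding s_def by (intro half_gt_zero zero_less_power)
  have t0: "t \<ge> 0" by (simp add: t_def)
  have rq: "r = q * s"
  proof -
    have "e * d / 2 = e / d * (d\<^sup>2 / 2)" if "d > 0" for d e :: real
      using that by (simp add: power2_eq_square)
    moreover have "(sqrt b - sqrt a) * (sqrt b + sqrt a) = b - a"
      using sq(1,2) by (simp only: algebra_simps)
    ultimately show ?thesis using add_pos_pos[OF sq(4,3)] unfolding r_def q s_def by metis
  qed
  have st: "s + t = 2 * c"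
    using sq by (simp add: s_def t_def c_def power2_eq_square field_simps)
  have tq: "t = q\<^sup>2 * s"
  proof -
    have "e\<^sup>2 / 2 = (e / d)\<^sup>2 * (d\<^sup>2 / 2)" if "d > 0" for d e :: real
      using that by (simp add: power_divide)
    from this[OF add_pos_pos[OF sq(4,3)], of "sqrt b - sqrt a"]
    show ?thesis unfolding t_def q s_def .
  qed
  then have st': "s * t = r\<^sup>2" by (simp add: rq power2_eq_square)
  obtain z z' w w' \<sigma> \<sigma>' where V: "z \<in> V" "z' \<in> V" and w: "w \<in> N (m - 1)" "w' \<in> N m"
    and z: "z = \<sigma> *\<^sub>R f - w" "z' = \<sigma>' *\<^sub>R f - w'"
    and \<sigma>: "\<sigma>' - s * \<sigma> = t ^ m" "\<sigma>' - t * \<sigma> = s ^ m"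
    and norm: "ip z' z' - 2 * ip z' (c *\<^sub>R z - A z) + r\<^sup>2 * ip z z = r ^ (2 * m) * ip f f"
    using chebyshev_sequence[OF f st st' N] by metis
  \<comment> \<open>x is r^m T_m((c - A) / r) f, by T_m = U_m - x U_{m-1}, and \<tau> is the same
    polynomial at A = 0. As 2 \<tau> = s^m + t^m \<ge> s^m and r = q s, dividing by \<tau> leaves at
    most 2 q^m.\<close>
  define x y \<tau> where "x = z' - (c *\<^sub>R z - A z)" and "y = w' - c *\<^sub>R w - \<sigma> *\<^sub>R A f + A w"
    and "\<tau> = \<sigma>' - c * \<sigma>"
  have wV: "w \<in> V" "w' \<in> V" using w N(2) by blast+
  have xV: "x \<in> V" using V by (simp add: x_def)
  have x: "x = \<tau> *\<^sub>R f - y"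
    using f wV by (simp add: x_def y_def \<tau>_def z A_diff A_scale algebra_simps)
  have mono: "N i \<subseteq> N j" if "i \<le> j" for i j
    using that N(3) by (rule lift_Suc_mono_le[rotated])
  have "w \<in> N m" "A f \<in> N m" "A w \<in> N m"
    using w N(4)[OF w(1)] N(5) subsetD[OF mono[of "m - 1" m]] subsetD[OF mono[of 1 m]] Suc by simp_all
  then have y: "y \<in> N m"
    unfolding y_def using w by (intro subspace_diff[OF N(1)] subspace_add[OF N(1)] subspace_scale[OF N(1)])
  have c: "c = (s + t) / 2" using st by simp
  have "2 * \<tau> = s ^ m + t ^ m" unfolding \<tau>_def c \<sigma>[symmetric] by (simp add: algebra_simps)
  then have \<tau>: "s ^ m \<le> 2 * \<tau>" using t0 by simp
  have \<tau>0: "\<tau> > 0" using \<tau> s0 by (smt (verit) zero_less_power)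
  have "eigenvalues \<subseteq> {c - r..c + r}" using eig by (simp add: c_def r_def field_simps)
  then have "ip (c *\<^sub>R z - A z) (c *\<^sub>R z - A z) \<le> r\<^sup>2 * ip z z" using V(1) by (rule shift_norm_bound)
  \<comment> \<open>Estimating the last term by r^2 |z|^2 turns the right-hand side into the
    invariant of the sequence.\<close>
  moreover have "ip x x = ip z' z' - 2 * ip z' (c *\<^sub>R z - A z) + ip (c *\<^sub>R z - A z) (c *\<^sub>R z - A z)"
    unfolding x_def using V ip_commute[of z' "c *\<^sub>R z - A z"] by (simp add: ip_diff_left ip_diff_right)
  ultimately have xx: "ip x x \<le> r ^ (2 * m) * ip f f" using norm by linarith
  have coeff: "(1 / \<tau>)\<^sup>2 * r ^ (2 * m) \<le> (2 * q ^ m)\<^sup>2"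
  proof -
    have "q \<ge> 0" using sq ab by (simp add: q)
    then have "r ^ m \<le> 2 * q ^ m * \<tau>"
      using mult_left_mono[OF \<tau>, of "q ^ m"] by (simp add: rq power_mult_distrib)
    then have "r ^ m / \<tau> \<le> 2 * q ^ m" using \<tau>0 by (simp add: divide_simps)
    moreover have "0 \<le> r ^ m / \<tau>" using \<tau>0 ab by (simp add: r_def)
    ultimately have "(r ^ m / \<tau>)\<^sup>2 \<le> (2 * q ^ m)\<^sup>2" by (intro power_mono)
    then show ?thesis by (simp add: power_divide mult.commute[of 2 m] power_mult)
  qed
  have fy: "f - (1 / \<tau>) *\<^sub>R y = (1 / \<tau>) *\<^sub>R x"
    using \<tau>0 by (simp add: x scaleR_diff_right)
  have "ip (f - (1 / \<tau>) *\<^sub>R y) (f - (1 / \<tau>) *\<^sub>R y) = (1 / \<tau>)\<^sup>2 * ip x x"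
    unfolding fy using xV by (simp add: ip_scale_left ip_scale_right power2_eq_square)
  also have "\<dots> \<le> (1 / \<tau>)\<^sup>2 * (r ^ (2 * m) * ip f f)"
    using xx by (intro mult_left_mono) auto
  also have "\<dots> \<le> (2 * q ^ m)\<^sup>2 * ip f f"
    using mult_right_mono[OF coeff ip_nonneg[OF f]] by (simp only: mult.assoc)
  finally have "ip (f - (1 / \<tau>) *\<^sub>R y) (f - (1 / \<tau>) *\<^sub>R y) \<le> (2 * q ^ m)\<^sup>2 * ip f f" .
  then show ?thesis using that[of "(1 / \<tau>) *\<^sub>R y"] subspace_scale[OF N(1) y] by blast
qed

end

section \<open>Polynomials and square integrable functions\<close>

text \<open>Makes honest functions a real vector space, so that subspaces, spans and the abstract
  locales apply to representatives instead of classes modulo null sets.\<close>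

instantiation "fun" :: (type, real_vector) real_vector
begin

definition "a *\<^sub>R f = (\<lambda>x. a *\<^sub>R f x)"

instance
  by standard (auto simp: scaleR_fun_def fun_eq_iff algebra_simps)

end

lemma scaleR_fun_apply [simp]: "(a *\<^sub>R f) x = a *\<^sub>R f x"
  by (simp add: scaleR_fun_def)

lemma sum_fun_apply: "(\<Sum>i\<in>I. f i) x = (\<Sum>i\<in>I. f i x)"
  by (induction I rule: infinite_finite_induct) auto

section \<open>Polynomials of bounded total degree\<close>

abbreviation multi_indices :: "nat \<Rightarrow> ('a::euclidean_space \<Rightarrow> nat) set" where
  "multi_indices K \<equiv> {\<alpha>. (\<forall>b. b \<notin> Basis \<longrightarrow> \<alpha> b = 0) \<and> (\<Sum>b\<in>Basis. \<alpha> b) \<le> K}"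

lemma finite_multi_indices: "finite (multi_indices K :: ('a::euclidean_space \<Rightarrow> nat) set)"
proof (rule finite_subset)
  show "multi_indices K \<subseteq> {\<alpha>. \<forall>b::'a. (b \<in> Basis \<longrightarrow> \<alpha> b \<in> {..K}) \<and> (b \<notin> Basis \<longrightarrow> \<alpha> b = 0)}"
  proof clarsimp
    fix \<alpha> :: "'a \<Rightarrow> nat" and b :: 'a assume "sum \<alpha> Basis \<le> K" "b \<in> Basis"
    then show "\<alpha> b \<le> K" using member_le_sum[of b Basis \<alpha>] by simp
  qed
  show "finite {\<alpha>. \<forall>b::'a. (b \<in> Basis \<longrightarrow> \<alpha> b \<in> {..K}) \<and> (b \<notin> Basis \<longrightarrow> \<alpha> b = 0)}"
    by (rule finite_set_of_finite_funs) auto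
qed

lemma polynomial_deg_le_const: "polynomial_deg_le K (\<lambda>x::'a::euclidean_space. a)"
  unfolding polynomial_deg_le_def
proof (intro exI[of _ "\<lambda>\<alpha>. if \<alpha> = (\<lambda>_. 0) then a else 0"] allI)
  fix x :: 'a
  have "(\<Sum>\<alpha>\<in>(multi_indices K :: ('a \<Rightarrow> nat) set). (if \<alpha> = (\<lambda>_. 0) then a else 0) * (\<Prod>b\<in>Basis. (x \<bullet> b) ^ \<alpha> b)) =
    (\<Sum>\<alpha>\<in>(multi_indices K :: ('a \<Rightarrow> nat) set). if \<alpha> = (\<lambda>_. 0) then a else 0)"
    by (intro sum.cong) auto
  also have "\<dots> = a" using finite_multi_indices[of K, where 'a='a] by (subst sum.delta) auto
  finally show "a = (\<Sum>\<alpha>\<in>multi_indices K. (if \<alpha> = (\<lambda>_. 0) then a else 0) * (\<Prod>b\<in>Basis. (x \<bullet> b) ^ \<alpha> b))"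
    by simp
qed

lemma polynomial_deg_le_lincomb:
  assumes "polynomial_deg_le K p" "polynomial_deg_le K p'"
  shows "polynomial_deg_le K (\<lambda>x. a * p x + a' * p' x)"
proof -
  obtain c c' where
    "\<forall>x. p x = (\<Sum>\<alpha>\<in>multi_indices K. c \<alpha> * (\<Prod>b\<in>Basis. (x \<bullet> b) ^ \<alpha> b))"
    "\<forall>x. p' x = (\<Sum>\<alpha>\<in>multi_indices K. c' \<alpha> * (\<Prod>b\<in>Basis. (x \<bullet> b) ^ \<alpha> b))"
    using assms unfolding polynomial_deg_le_def by blast
  then show ?thesis unfolding polynomial_deg_le_def
    by (intro exI[of _ "\<lambda>\<alpha>. a * c \<alpha> + a' * c' \<alpha>"])
      (simp add: sum_distrib_left sum.distrib algebra_simps)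
qed

lemma continuous_on_polynomial_deg_le:
  assumes "polynomial_deg_le K p" shows "continuous_on S p"
proof -
  obtain c where "p = (\<lambda>x. \<Sum>\<alpha>\<in>multi_indices K. c \<alpha> * (\<Prod>b\<in>Basis. (x \<bullet> b) ^ \<alpha> b))"
    using assms unfolding polynomial_deg_le_def by blast
  then show ?thesis by (simp only:) (intro continuous_intros)
qed

text \<open>Restricted to a line through a point of the open set, the polynomial is univariate.\<close>

lemma polynomial_deg_le_zero_on_open:
  fixes p :: "'a::euclidean_space \<Rightarrow> real"
  assumes p: "polynomial_deg_le K p" and U: "open U" "x0 \<in> U" "\<And>x. x \<in> U \<Longrightarrow> p x = 0"
  shows "p y = 0"
proof -
  obtain c where c: "\<And>x. p x = (\<Sum>\<alpha>\<in>multi_indices K. c \<alpha> * (\<Prod>b\<in>Basis. (x \<bullet> b) ^ \<alpha> b))"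
    using p unfolding polynomial_deg_le_def by blast
  define d where "d = y - x0"
  define P where "P = (\<Sum>\<alpha>\<in>multi_indices K. [:c \<alpha>:] * (\<Prod>b\<in>Basis. [:x0 \<bullet> b, d \<bullet> b:] ^ \<alpha> b))"
  have P: "poly P t = p (x0 + t *\<^sub>R d)" for t
    unfolding P_def c by (simp add: poly_sum poly_prod inner_add_left)
  have "isCont (\<lambda>t::real. x0 + t *\<^sub>R d) 0" by (intro continuous_intros)
  then have "((\<lambda>t. x0 + t *\<^sub>R d) \<longlongrightarrow> x0) (at 0)" by (simp add: isCont_def)
  then have "\<forall>\<^sub>F t in at 0. x0 + t *\<^sub>R d \<in> U" using U(1,2) by (rule topological_tendstoD)
  then obtain e where e: "e > 0" "\<And>t. t \<noteq> 0 \<Longrightarrow> dist t 0 < e \<Longrightarrow> x0 + t *\<^sub>R d \<in> U"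
    unfolding eventually_at by auto
  have "{0<..<e} \<subseteq> {t. poly P t = 0}"
    using e(2) U(3) by (auto simp: P)
  moreover have "infinite {0<..<e}" using e(1) by simp
  ultimately have "P = 0" using poly_roots_finite[of P] infinite_super by blast
  then have "poly P 1 = 0" by simp
  then show ?thesis by (simp add: P d_def)
qed

section \<open>Square integrable functions and their inner product\<close>

lemma L2_mult_integrable:
  assumes "u \<in> L2 \<Omega>" "v \<in> L2 \<Omega>"
  shows "integrable (lebesgue_on \<Omega>) (\<lambda>x. u x * v x)"
proof (rule Bochner_Integration.integrable_bound)
  show "integrable (lebesgue_on \<Omega>) (\<lambda>x. (u x)\<^sup>2 + (v x)\<^sup>2)"
    using assms by (auto simp: L2_def)
  show "(\<lambda>x. u x * v x) \<in> borel_measurable (lebesgue_on \<Omega>)"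
    using assms by (intro borel_measurable_times) (auto simp: L2_def)
  have "\<bar>a * b\<bar> \<le> a\<^sup>2 + b\<^sup>2" for a b :: real
    using sum_squares_bound[of "\<bar>a\<bar>" "\<bar>b\<bar>"] mult_nonneg_nonneg[of "\<bar>a\<bar>" "\<bar>b\<bar>"] unfolding abs_mult power2_abs by linarith
  then show "AE x in lebesgue_on \<Omega>. norm (u x * v x) \<le> norm ((u x)\<^sup>2 + (v x)\<^sup>2)"
    by auto
qed

lemma L2_lincomb:
  assumes u: "u \<in> L2 \<Omega>" and v: "v \<in> L2 \<Omega>"
  shows "(\<lambda>x. a * u x + b * v x) \<in> L2 \<Omega>"
proof -
  have "integrable (lebesgue_on \<Omega>) (\<lambda>x. a\<^sup>2 * (u x)\<^sup>2 + 2 * a * b * (u x * v x) + b\<^sup>2 * (v x)\<^sup>2)"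
    using u v L2_mult_integrable[OF u v] by (auto simp: L2_def)
  then show ?thesis using u v
    by (auto simp: L2_def power2_sum power_mult_distrib algebra_simps)
qed

lemma L2_add: "u \<in> L2 \<Omega> \<Longrightarrow> v \<in> L2 \<Omega> \<Longrightarrow> u + v \<in> L2 \<Omega>"
  using L2_lincomb[of u \<Omega> v 1 1] by (simp add: plus_fun_def)

lemma L2_scaleR: "u \<in> L2 \<Omega> \<Longrightarrow> a *\<^sub>R u \<in> L2 \<Omega>"
  using L2_lincomb[of u \<Omega> u a 0] by (simp add: scaleR_fun_def)

lemma L2_bounded_mult:
  assumes u: "u \<in> L2 \<Omega>" and g: "g \<in> borel_measurable (lebesgue_on \<Omega>)"
    and B: "AE x in lebesgue_on \<Omega>. \<bar>g x\<bar> \<le> B"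
  shows "(\<lambda>x. g x * u x) \<in> L2 \<Omega>"
  unfolding L2_def
proof (intro CollectI conjI)
  show m: "(\<lambda>x. g x * u x) \<in> borel_measurable (lebesgue_on \<Omega>)"
    using u g by (auto simp: L2_def)
  show "integrable (lebesgue_on \<Omega>) (\<lambda>x. (g x * u x)\<^sup>2)"
  proof (rule Bochner_Integration.integrable_bound)
    show "integrable (lebesgue_on \<Omega>) (\<lambda>x. B\<^sup>2 * (u x)\<^sup>2)"
      using u by (auto simp: L2_def)
    show "(\<lambda>x. (g x * u x)\<^sup>2) \<in> borel_measurable (lebesgue_on \<Omega>)"
      using m by measurable
    show "AE x in lebesgue_on \<Omega>. norm ((g x * u x)\<^sup>2) \<le> norm (B\<^sup>2 * (u x)\<^sup>2)"
      using B
    proof eventually_elim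
      case (elim x)
      then have "(g x)\<^sup>2 \<le> B\<^sup>2" using power_mono[of "\<bar>g x\<bar>" B 2] by simp
      then show ?case by (simp add: power_mult_distrib mult_right_mono)
    qed
  qed
qed

lemma L2_inner_commute: "L2_inner \<Omega> u v = L2_inner \<Omega> v u"
  by (simp add: L2_inner_def mult.commute)

lemma L2_inner_add_left:
  "u \<in> L2 \<Omega> \<Longrightarrow> v \<in> L2 \<Omega> \<Longrightarrow> w \<in> L2 \<Omega> \<Longrightarrow>
    L2_inner \<Omega> (u + v) w = L2_inner \<Omega> u w + L2_inner \<Omega> v w"
  by (simp add: L2_inner_def distrib_right Bochner_Integration.integral_add L2_mult_integrable)

lemma L2_inner_scaleR_left: "L2_inner \<Omega> (a *\<^sub>R u) v = a * L2_inner \<Omega> u v"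
  by (simp add: L2_inner_def mult.assoc)

lemma L2_inner_cong_AE:
  assumes "u \<in> L2 \<Omega>" "v \<in> L2 \<Omega>" "w \<in> L2 \<Omega>" "AE x in lebesgue_on \<Omega>. u x = v x"
  shows "L2_inner \<Omega> u w = L2_inner \<Omega> v w"
  unfolding L2_inner_def
  using assms by (intro integral_cong_AE borel_measurable_times) (auto simp: L2_def)

lemma L2_inner_self: "L2_inner \<Omega> u u = (L2_norm \<Omega> u)\<^sup>2"
  by (simp add: L2_inner_def L2_norm_def power2_eq_square)

lemma L2_inner_self_nonneg: "0 \<le> L2_inner \<Omega> u u"
  by (simp add: L2_inner_self)

text \<open>The points of \<open>\<Omega> \<inter> U\<close> where \<open>f\<close> is nonzero form
  an open null set, which must be empty. The version local to \<open>U\<close> is what essential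
  supports require.\<close>

lemma continuous_on_AE_zero_imp_zero:
  fixes f :: "'a::euclidean_space \<Rightarrow> real"
  assumes "open \<Omega>" "continuous_on \<Omega> f" and U: "open U"
    and AE: "AE x in lebesgue_on \<Omega>. x \<in> U \<longrightarrow> f x = 0" and x: "x \<in> \<Omega>" "x \<in> U"
  shows "f x = 0"
proof -
  have "open (\<Omega> \<inter> f -` (- {0}))"
    using assms(1,2) by (metis continuous_on_open_vimage open_Compl closed_singleton Int_commute)
  then have op: "open (\<Omega> \<inter> f -` (- {0}) \<inter> U)" using U by (rule open_Int)
  have \<Omega>: "\<Omega> \<in> sets lebesgue" using assms(1) by auto
  have "AE x in lebesgue. x \<in> \<Omega> \<longrightarrow> x \<in> U \<longrightarrow> f x = 0"
    using AE \<Omega> by (subst (asm) AE_restrict_space_iff) auto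
  then have "AE x in lebesgue. x \<notin> \<Omega> \<inter> f -` (- {0}) \<inter> U" by eventually_elim auto
  then have "\<Omega> \<inter> f -` (- {0}) \<inter> U \<in> null_sets lebesgue"
    using op by (subst (asm) AE_iff_null_sets[symmetric]) auto
  then have "negligible (\<Omega> \<inter> f -` (- {0}) \<inter> U)" by (simp add: negligible_iff_null_sets)
  then have "\<Omega> \<inter> f -` (- {0}) \<inter> U = {}" using open_not_negligible[OF op] by blast
  then show ?thesis using x by auto
qed

section \<open>Finite elements on a simplicial mesh\<close>

locale simplicial_mesh =
  fixes \<Omega> :: "'a::euclidean_space set" and \<T> :: "'a set set"
  assumes domain: "polyhedral_domain \<Omega>" and mesh: "triangulation_of \<T> \<Omega>"
begin

lemma open_domain: "open \<Omega>" and bounded_domain: "bounded \<Omega>" and domain_nonempty: "\<Omega> \<noteq> {}"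
  using domain by (auto simp: polyhedral_domain_def)

lemma sets_domain [measurable, simp]: "\<Omega> \<in> sets lebesgue"
  using open_domain by auto

lemma finite_mesh: "finite \<T>" and Union_mesh: "\<Union>\<T> = closure \<Omega>"
  using mesh by (auto simp: triangulation_of_def triangulation_def)

lemma cell_simplex: "T \<in> \<T> \<Longrightarrow> int DIM('a) simplex T"
  and interior_cell_subset: "T \<in> \<T> \<Longrightarrow> interior T \<subseteq> \<Omega>"
  using mesh by (auto simp: triangulation_of_def)

lemma cell_props:
  assumes "T \<in> \<T>"
  shows "convex T" "closed T" "compact T" "interior T \<noteq> {}" "closure (interior T) = T"
proof -
  note s = cell_simplex[OF assms]
  show c: "convex T" "closed T" "compact T"
    using s by (auto intro: convex_simplex closed_simplex compact_simplex)
  have "T \<noteq> {}" using s by auto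
  then have "rel_interior T \<noteq> {}" using c by (simp add: rel_interior_eq_empty)
  then show i: "interior T \<noteq> {}"
    using interior_rel_interior_gen[of T] aff_dim_simplex[OF s] by simp
  show "closure (interior T) = T" using convex_closure_interior[OF c(1) i] c(2) by simp
qed

text \<open>The common face meets the interior of \<open>T\<close>, so it is all of
  \<open>T\<close>. Then \<open>T\<close> is a face of \<open>T'\<close> with nonempty interior,
  which is possible only for \<open>T = T'\<close>.\<close>

lemma interior_disjoint_cell:
  assumes "T \<in> \<T>" "T' \<in> \<T>" "T \<noteq> T'" shows "interior T \<inter> T' = {}"
proof (rule ccontr)
  assume ne: "interior T \<inter> T' \<noteq> {}"
  have f: "T \<inter> T' face_of T" "T \<inter> T' face_of T'"
    using mesh assms Int_commute[of T T'] unfolding triangulation_of_def triangulation_def by metis+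
  have "T \<inter> T' = T"
    using face_of_disjoint_interior[OF f(1)] ne interior_subset[of T] by blast
  then have "T face_of T'" "T \<subseteq> T'" using f(2) by auto
  moreover have "T \<inter> interior T' \<noteq> {}"
    using interior_mono[OF \<open>T \<subseteq> T'\<close>] cell_props(4)[OF assms(1)] interior_subset[of T] by blast
  ultimately show False using face_of_disjoint_interior[of T T'] assms(3) by blast
qed

text \<open>Frontiers of finitely many convex cells are null. Every cellwise argument below passes
  through this lemma.\<close>

lemma AE_interior: "AE x in lebesgue_on \<Omega>. \<exists>T\<in>\<T>. x \<in> interior T"
proof -
  have "negligible (\<Union>T\<in>\<T>. frontier T)"
    using finite_mesh cell_props(1) by (auto intro!: negligible_Union negligible_convex_frontier)
  then have "AE x in lebesgue. x \<notin> (\<Union>T\<in>\<T>. frontier T)"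
    by (intro AE_not_in) (simp add: negligible_iff_null_sets)
  then have "AE x in lebesgue. x \<in> \<Omega> \<longrightarrow> (\<exists>T\<in>\<T>. x \<in> interior T)"
  proof eventually_elim
    case (elim x)
    show ?case
    proof
      assume "x \<in> \<Omega>"
      then obtain T where T: "T \<in> \<T>" "x \<in> T" using Union_mesh closure_subset[of \<Omega>] by blast
      then have "x \<in> interior T"
        using elim cell_props(2)[OF T(1)] by (auto simp: frontier_def)
      then show "\<exists>T\<in>\<T>. x \<in> interior T" using T by blast
    qed
  qed
  then show ?thesis by (subst AE_restrict_space_iff) auto
qed

lemma interior_cell_sets: "T \<in> \<T> \<Longrightarrow> interior T \<in> sets (lebesgue_on \<Omega>)"
  using interior_cell_subset[of T] by (auto simp: sets_restrict_space_iff)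

lemma bounded_measurable_L2:
  assumes "f \<in> borel_measurable (lebesgue_on \<Omega>)" "\<And>x. x \<in> \<Omega> \<Longrightarrow> \<bar>f x\<bar> \<le> B"
  shows "f \<in> L2 \<Omega>"
proof -
  interpret finite_measure "lebesgue_on \<Omega>"
    using lmeasurable_open[OF bounded_domain open_domain] by (rule finite_measure_lebesgue_on)
  have one: "(\<lambda>x. 1) \<in> L2 \<Omega>" by (simp add: L2_def)
  have "AE x in lebesgue_on \<Omega>. \<bar>f x\<bar> \<le> B" using assms(2) by (intro AE_I2) simp
  then show ?thesis using L2_bounded_mult[OF one assms(1)] by simp
qed

text \<open>Continuity on the open set \<open>\<Omega>\<close> alone would allow blow-up at the
  boundary; boundedness comes from the polynomials on the compact cells.\<close>

lemma lagrange_space_L2: assumes "f \<in> lagrange_space K \<T> \<Omega>" shows "f \<in> L2 \<Omega>"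
proof -
  have "\<exists>B. \<forall>x\<in>T \<inter> \<Omega>. \<bar>f x\<bar> \<le> B" if T: "T \<in> \<T>" for T
  proof -
    obtain p where p: "polynomial_deg_le K p" "\<forall>x \<in> T \<inter> \<Omega>. f x = p x"
      using assms T by (auto simp: lagrange_space_def)
    have "bounded (p ` T)"
      using cell_props(3)[OF T] continuous_on_polynomial_deg_le[OF p(1)]
      by (intro compact_imp_bounded compact_continuous_image)
    then show ?thesis using p(2) by (fastforce simp: bounded_iff)
  qed
  then obtain B where B: "\<And>T x. T \<in> \<T> \<Longrightarrow> x \<in> T \<inter> \<Omega> \<Longrightarrow> \<bar>f x\<bar> \<le> B T" by metis
  have "\<bar>f x\<bar> \<le> (\<Sum>T\<in>\<T>. \<bar>B T\<bar>)" if x: "x \<in> \<Omega>" for x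
  proof -
    obtain T where T: "T \<in> \<T>" "x \<in> T" using x Union_mesh closure_subset[of \<Omega>] by blast
    have "\<bar>f x\<bar> \<le> \<bar>B T\<bar>" using B[of T x] T x by force
    also have "\<dots> \<le> (\<Sum>T\<in>\<T>. \<bar>B T\<bar>)" using finite_mesh T by (intro member_le_sum) auto
    finally show ?thesis .
  qed
  moreover have "f \<in> borel_measurable (lebesgue_on \<Omega>)"
    using assms by (intro continuous_imp_measurable_on_sets_lebesgue) (auto simp: lagrange_space_def)
  ultimately show ?thesis using bounded_measurable_L2 by blast
qed

text \<open>
  Extending by zero outside \<open>\<Omega>\<close> picks one representative of each element of the finite element space,
  so that equality almost everywhere becomes equality.
\<close>

definition fe_space :: "nat \<Rightarrow> ('a \<Rightarrow> real) set" where
  "fe_space K = {f \<in> lagrange_space K \<T> \<Omega>. \<forall>x. x \<notin> \<Omega> \<longrightarrow> f x = 0}"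

definition zero_ext :: "('a \<Rightarrow> real) \<Rightarrow> 'a \<Rightarrow> real" where
  "zero_ext f x = (if x \<in> \<Omega> then f x else 0)"

lemma zero_ext_apply [simp]: "x \<in> \<Omega> \<Longrightarrow> zero_ext f x = f x"
  by (simp add: zero_ext_def)

lemma AE_zero_ext: "AE x in lebesgue_on \<Omega>. zero_ext f x = f x"
  by (intro AE_I2) simp

lemma zero_ext_fe_space: "f \<in> lagrange_space K \<T> \<Omega> \<Longrightarrow> zero_ext f \<in> fe_space K"
  by (auto simp: fe_space_def lagrange_space_def zero_ext_def cong: continuous_on_cong_simp)

lemma fe_space_L2: "f \<in> fe_space K \<Longrightarrow> f \<in> L2 \<Omega>"
  using lagrange_space_L2 by (auto simp: fe_space_def)

lemma fe_space_continuous: "f \<in> fe_space K \<Longrightarrow> continuous_on \<Omega> f"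
  by (auto simp: fe_space_def lagrange_space_def)

lemma fe_space_polynomial:
  "f \<in> fe_space K \<Longrightarrow> T \<in> \<T> \<Longrightarrow> \<exists>p. polynomial_deg_le K p \<and> (\<forall>x \<in> T \<inter> \<Omega>. f x = p x)"
  by (auto simp: fe_space_def lagrange_space_def)

lemma fe_space_lincomb:
  assumes "f \<in> fe_space K" "g \<in> fe_space K" shows "a *\<^sub>R f + b *\<^sub>R g \<in> fe_space K"
proof -
  have "continuous_on \<Omega> (\<lambda>x. a * f x + b * g x)"
    using assms by (intro continuous_intros fe_space_continuous)
  moreover have "\<exists>p. polynomial_deg_le K p \<and> (\<forall>x \<in> T \<inter> \<Omega>. a * f x + b * g x = p x)" if "T \<in> \<T>" for T
    using fe_space_polynomial[OF assms(1) that] fe_space_polynomial[OF assms(2) that]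
      polynomial_deg_le_lincomb by (metis (no_types, lifting))
  moreover have "a *\<^sub>R f + b *\<^sub>R g = (\<lambda>x. a * f x + b * g x)" by auto
  ultimately show ?thesis using assms by (simp add: fe_space_def lagrange_space_def)
qed

lemma subspace_fe_space: "subspace (fe_space K)"
proof -
  have "(\<lambda>x. 0) \<in> fe_space K"
    using polynomial_deg_le_const[of K 0] by (auto simp: fe_space_def lagrange_space_def)
  then have "0 \<in> fe_space K" by (simp add: zero_fun_def)
  moreover have "f + g \<in> fe_space K" if "f \<in> fe_space K" "g \<in> fe_space K" for f g
    using fe_space_lincomb[OF that, of 1 1] by simp
  moreover have "a *\<^sub>R f \<in> fe_space K" if "f \<in> fe_space K" for a f
    using fe_space_lincomb[OF that that, of a 0] by simp
  ultimately show ?thesis by (simp add: subspace_def)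
qed

lemma fe_space_AE_zero:
  assumes f: "f \<in> fe_space K" and AE: "AE x in lebesgue_on \<Omega>. f x = 0" shows "f = 0"
proof
  fix x
  show "f x = 0 x"
    using continuous_on_AE_zero_imp_zero[OF open_domain fe_space_continuous[OF f] open_UNIV, of x] AE f
    by (cases "x \<in> \<Omega>") (auto simp: fe_space_def)
qed

lemma fe_space_AE_eq:
  assumes "f \<in> fe_space K" "g \<in> fe_space K" "AE x in lebesgue_on \<Omega>. f x = g x" shows "f = g"
proof -
  have "f - g \<in> fe_space K" using subspace_diff[OF subspace_fe_space] assms by blast
  moreover have "AE x in lebesgue_on \<Omega>. (f - g) x = 0" using assms(3) by eventually_elim simp
  ultimately have "f - g = 0" by (rule fe_space_AE_zero)
  then show ?thesis by simp
qed

lemma fe_space_finite_dim: "\<exists>F. finite F \<and> fe_space K \<subseteq> span F"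
proof -
  have "\<forall>x\<in>\<Omega>. \<exists>T\<in>\<T>. x \<in> T" using Union_mesh closure_subset[of \<Omega>] by blast
  \<comment> \<open>Each point is assigned to one cell, so points on common faces are counted once.
    The cut-off monomials \<open>e\<close> may be discontinuous; they only have to span a
    superspace.\<close>
  then obtain cell where cell: "\<And>x. x \<in> \<Omega> \<Longrightarrow> cell x \<in> \<T> \<and> x \<in> cell x" by metis
  define e where "e T \<alpha> = (\<lambda>x. if x \<in> \<Omega> \<and> cell x = T then \<Prod>b\<in>Basis. (x \<bullet> b) ^ \<alpha> b else 0)"
    for T and \<alpha> :: "'a \<Rightarrow> nat"
  define F where "F = case_prod e ` (\<T> \<times> multi_indices K)"
  have "finite F" unfolding F_def using finite_mesh finite_multi_indices by blast
  moreover have "f \<in> span F" if f: "f \<in> fe_space K" for f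
  proof -
    have "\<forall>T\<in>\<T>. \<exists>c. \<forall>x\<in>T \<inter> \<Omega>. f x = (\<Sum>\<alpha>\<in>multi_indices K. c \<alpha> * (\<Prod>b\<in>Basis. (x \<bullet> b) ^ \<alpha> b))"
    proof
      fix T assume "T \<in> \<T>"
      then obtain p where p: "polynomial_deg_le K p" "\<forall>x \<in> T \<inter> \<Omega>. f x = p x"
        using fe_space_polynomial[OF f] by blast
      from p(1) obtain c where "\<forall>x. p x = (\<Sum>\<alpha>\<in>multi_indices K. c \<alpha> * (\<Prod>b\<in>Basis. (x \<bullet> b) ^ \<alpha> b))"
        unfolding polynomial_deg_le_def by blast
      then show "\<exists>c. \<forall>x\<in>T \<inter> \<Omega>. f x = (\<Sum>\<alpha>\<in>multi_indices K. c \<alpha> * (\<Prod>b\<in>Basis. (x \<bullet> b) ^ \<alpha> b))"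
        using p(2) by (intro exI[of _ c]) simp
    qed
    from bchoice[OF this] obtain c where c: "\<And>T x. T \<in> \<T> \<Longrightarrow> x \<in> T \<inter> \<Omega> \<Longrightarrow>
        f x = (\<Sum>\<alpha>\<in>multi_indices K. c T \<alpha> * (\<Prod>b\<in>Basis. (x \<bullet> b) ^ \<alpha> b))"
      by blast
    have "f = (\<Sum>T\<in>\<T>. \<Sum>\<alpha>\<in>multi_indices K. c T \<alpha> *\<^sub>R e T \<alpha>)"
    proof
      fix x
      show "f x = (\<Sum>T\<in>\<T>. \<Sum>\<alpha>\<in>multi_indices K. c T \<alpha> *\<^sub>R e T \<alpha>) x"
      proof (cases "x \<in> \<Omega>")
        case True
        have "(\<Sum>T\<in>\<T>. \<Sum>\<alpha>\<in>multi_indices K. c T \<alpha> *\<^sub>R e T \<alpha>) x =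
            (\<Sum>T\<in>\<T>. if cell x = T then \<Sum>\<alpha>\<in>multi_indices K. c T \<alpha> * (\<Prod>b\<in>Basis. (x \<bullet> b) ^ \<alpha> b) else 0)"
          using True by (auto simp: sum_fun_apply e_def intro!: sum.cong)
        also have "\<dots> = f x"
          using cell[OF True] c[of "cell x" x] True finite_mesh by simp
        finally show ?thesis by simp
      next
        case False
        then show ?thesis using f by (simp add: sum_fun_apply e_def fe_space_def)
      qed
    qed
    moreover have "(\<Sum>T\<in>\<T>. \<Sum>\<alpha>\<in>multi_indices K. c T \<alpha> *\<^sub>R e T \<alpha>) \<in> span F"
      by (intro span_sum span_scale span_base) (auto simp: F_def)
    ultimately show ?thesis by simp
  qed
  ultimately show ?thesis by blast
qed

lemma inner_subspace_fe_space: "inner_subspace (fe_space K) (L2_inner \<Omega>)"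
proof
  show "subspace (fe_space K)" by (rule subspace_fe_space)
  show "L2_inner \<Omega> (f + g) h = L2_inner \<Omega> f h + L2_inner \<Omega> g h"
    if "f \<in> fe_space K" "g \<in> fe_space K" "h \<in> fe_space K" for f g h
    using that by (intro L2_inner_add_left fe_space_L2)
  show "0 < L2_inner \<Omega> f f" if f: "f \<in> fe_space K" "f \<noteq> 0" for f
  proof -
    have "L2_inner \<Omega> f f \<noteq> 0"
    proof
      assume "L2_inner \<Omega> f f = 0"
      then have "AE x in lebesgue_on \<Omega>. f x * f x = 0"
        using L2_mult_integrable[OF fe_space_L2 fe_space_L2, OF f(1) f(1)]
        by (subst (asm) L2_inner_def, subst (asm) integral_nonneg_eq_0_iff_AE) auto
      then have "AE x in lebesgue_on \<Omega>. f x = 0" by simp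
      then show False using fe_space_AE_zero f by blast
    qed
    then show ?thesis using L2_inner_self_nonneg[of \<Omega> f] by linarith
  qed
qed (rule L2_inner_scaleR_left L2_inner_commute fe_space_finite_dim)+

lemma fe_space_nontrivial: "fe_space K \<noteq> {0}"
proof
  assume "fe_space K = {0}"
  moreover have "(\<lambda>_. 1) \<in> lagrange_space K \<T> \<Omega>"
    using polynomial_deg_le_const[of K 1] by (auto simp: lagrange_space_def)
  ultimately have "zero_ext (\<lambda>_. 1) = 0" using zero_ext_fe_space by blast
  then have "zero_ext (\<lambda>_. 1) x = 0" for x by simp
  then show False using domain_nonempty by (force simp: zero_ext_def split: if_splits)
qed

text \<open>If \<open>f\<close> vanished near a point of \<open>T\<close>, its polynomial on
  \<open>T\<close> would vanish on an open set and hence at \<open>x\<close>. Since (C4) speaks of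
  whole cells inside the support, this is how a single nonzero value becomes usable.\<close>

lemma fe_space_cell_subset_support:
  assumes f: "f \<in> fe_space K" and T: "T \<in> \<T>" and x: "x \<in> interior T" "f x \<noteq> 0"
  shows "T \<subseteq> ess_support \<Omega> f"
proof
  fix y assume y: "y \<in> T"
  show "y \<in> ess_support \<Omega> f"
    unfolding ess_support_def
  proof (intro CollectI allI impI notI)
    fix U assume U: "open U \<and> y \<in> U" and AE: "AE z in lebesgue_on \<Omega>. z \<in> U \<longrightarrow> f z = 0"
    have "y \<in> closure (interior T)" using y cell_props(5)[OF T] by simp
    then obtain z where z: "z \<in> U \<inter> interior T"
      using U open_Int_closure_eq_empty[of U "interior T"] by blast
    obtain p where p: "polynomial_deg_le K p" "\<forall>x \<in> T \<inter> \<Omega>. f x = p x"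
      using fe_space_polynomial[OF f T] by blast
    have sub: "interior T \<subseteq> T \<inter> \<Omega>" using interior_cell_subset[OF T] interior_subset by blast
    have "p w = 0" if "w \<in> U \<inter> interior T" for w
    proof -
      have "f w = 0" using that sub U AE
        by (intro continuous_on_AE_zero_imp_zero[OF open_domain fe_space_continuous[OF f], of U]) auto
      then show ?thesis using p(2) sub that by (metis IntD2 subsetD)
    qed
    then have "p x = 0"
      using polynomial_deg_le_zero_on_open[OF p(1), of "U \<inter> interior T" z] z U by auto
    then show False using x p(2) subsetD[OF sub x(1)] by simp
  qed
qed

lemma ess_support_subset_Union:
  assumes L: "L \<subseteq> \<T>" and u: "\<And>T x. T \<in> \<T> - L \<Longrightarrow> x \<in> interior T \<Longrightarrow> u x = 0"
  shows "ess_support \<Omega> u \<subseteq> \<Union>L"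
proof (rule subsetI, rule ccontr)
  fix x assume x: "x \<in> ess_support \<Omega> u" "x \<notin> \<Union>L"
  have "open (- \<Union>L)"
    using L finite_mesh cell_props(2) by (intro open_Compl closed_Union) (auto intro: finite_subset)
  moreover have "AE y in lebesgue_on \<Omega>. y \<in> - \<Union>L \<longrightarrow> u y = 0"
    using AE_interior
  proof eventually_elim
    case (elim y)
    then show ?case using u interior_subset by blast
  qed
  ultimately show False using x by (auto simp: ess_support_def)
qed

end

section \<open>The norm of L^2\<close>

lemma L2_norm_nonneg [simp]: "0 \<le> L2_norm \<Omega> u"
  by (simp add: L2_norm_def)

lemma L2_norm_scaleR: "L2_norm \<Omega> (a *\<^sub>R u) = \<bar>a\<bar> * L2_norm \<Omega> u"
  by (simp add: L2_norm_def power_mult_distrib real_sqrt_mult)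

lemma L2_norm_mono:
  assumes "u \<in> L2 \<Omega>" "v \<in> L2 \<Omega>" "AE x in lebesgue_on \<Omega>. \<bar>u x\<bar> \<le> \<bar>v x\<bar>"
  shows "L2_norm \<Omega> u \<le> L2_norm \<Omega> v"
  unfolding L2_norm_def
proof (intro real_sqrt_le_mono integral_mono_AE)
  show "AE x in lebesgue_on \<Omega>. (u x)\<^sup>2 \<le> (v x)\<^sup>2"
    using assms(3) by eventually_elim (simp add: abs_le_square_iff)
qed (use assms in \<open>auto simp: L2_def\<close>)

lemma L2_norm_cong_AE:
  assumes "u \<in> L2 \<Omega>" "v \<in> L2 \<Omega>" "AE x in lebesgue_on \<Omega>. u x = v x"
  shows "L2_norm \<Omega> u = L2_norm \<Omega> v"
  using assms by (intro antisym L2_norm_mono) (auto elim!: eventually_mono)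

lemma L2_norm_add_square:
  assumes "u \<in> L2 \<Omega>" "v \<in> L2 \<Omega>"
  shows "(L2_norm \<Omega> (u + v))\<^sup>2 = (L2_norm \<Omega> u)\<^sup>2 + 2 * L2_inner \<Omega> u v + (L2_norm \<Omega> v)\<^sup>2"
proof -
  have "L2_inner \<Omega> (u + v) (u + v) = L2_inner \<Omega> u (u + v) + L2_inner \<Omega> v (u + v)"
    using assms by (intro L2_inner_add_left L2_add)
  also have "\<dots> = L2_inner \<Omega> (u + v) u + L2_inner \<Omega> (u + v) v"
    by (simp only: L2_inner_commute)
  also have "\<dots> = L2_inner \<Omega> u u + 2 * L2_inner \<Omega> u v + L2_inner \<Omega> v v"
    using assms L2_inner_commute[of \<Omega> u v] by (simp add: L2_inner_add_left)
  finally show ?thesis by (simp add: L2_inner_self)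
qed

lemma L2_inner_scaleR_right: "L2_inner \<Omega> v (a *\<^sub>R u) = a * L2_inner \<Omega> v u"
  by (metis L2_inner_commute L2_inner_scaleR_left)

lemma L2_Cauchy_Schwarz:
  assumes u: "u \<in> L2 \<Omega>" and v: "v \<in> L2 \<Omega>"
  shows "L2_inner \<Omega> u v \<le> L2_norm \<Omega> u * L2_norm \<Omega> v"
proof -
  define a b h where "a = L2_norm \<Omega> u" and "b = L2_norm \<Omega> v" and "h = L2_inner \<Omega> u v"
  have ab: "a \<ge> 0" "b \<ge> 0" by (auto simp: a_def b_def)
  have key: "2 * x * y * h \<le> x\<^sup>2 * a\<^sup>2 + y\<^sup>2 * b\<^sup>2" for x y
  proof -
    have "0 \<le> (L2_norm \<Omega> (x *\<^sub>R u + (- y) *\<^sub>R v))\<^sup>2" by simp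
    also have "\<dots> = x\<^sup>2 * a\<^sup>2 - 2 * x * y * h + y\<^sup>2 * b\<^sup>2"
      by (subst L2_norm_add_square[OF L2_scaleR[OF u] L2_scaleR[OF v]])
        (simp only: L2_inner_scaleR_left L2_inner_scaleR_right L2_norm_scaleR power_mult_distrib power2_abs
          a_def b_def h_def, simp)
    finally show ?thesis by linarith
  qed
  \<comment> \<open>Choosing x = b, y = a in \<open>key\<close> would require division by a b, which
    may be 0. The shift by e > 0 avoids this and is removed in the limit.\<close>
  have bound: "h \<le> (a + e) * (b + e)" if e: "e > 0" for e
  proof -
    have p: "a + e > 0" "b + e > 0" using ab e by auto
    have "2 * ((a + e) * (b + e)) * h \<le> (b + e)\<^sup>2 * a\<^sup>2 + (a + e)\<^sup>2 * b\<^sup>2"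
      using key[of "b + e" "a + e"] by (simp only: mult_ac)
    also have "\<dots> \<le> (b + e)\<^sup>2 * (a + e)\<^sup>2 + (a + e)\<^sup>2 * (b + e)\<^sup>2"
      using ab e by (intro add_mono mult_left_mono power_mono) auto
    also have "\<dots> = 2 * ((a + e) * (b + e)) * ((a + e) * (b + e))"
      by (simp only: power2_eq_square mult_2 mult_ac flip: mult_2)
    finally show ?thesis using p by (subst (asm) mult_le_cancel_left_pos) auto
  qed
  have lim: "((\<lambda>e. (a + e) * (b + e)) \<longlongrightarrow> (a + 0) * (b + 0)) (at_right 0)"
    by (intro tendsto_intros)
  have "h \<le> (a + 0) * (b + 0)"
    by (rule tendsto_lowerbound[OF lim]) (auto simp: eventually_at_right_less intro!: eventually_mono[OF eventually_at_right_less] bound)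
  then show ?thesis by (simp add: a_def b_def h_def)
qed

lemma L2_norm_triangle:
  assumes "u \<in> L2 \<Omega>" "v \<in> L2 \<Omega>"
  shows "L2_norm \<Omega> (u + v) \<le> L2_norm \<Omega> u + L2_norm \<Omega> v"
proof (rule power2_le_imp_le)
  show "(L2_norm \<Omega> (u + v))\<^sup>2 \<le> (L2_norm \<Omega> u + L2_norm \<Omega> v)\<^sup>2"
    using L2_Cauchy_Schwarz[OF assms] by (simp add: L2_norm_add_square[OF assms] power2_sum)
qed simp

lemma L2_zero: "0 \<in> L2 \<Omega>"
  by (simp add: L2_def zero_fun_def)

lemma L2_sum: "(\<And>i. i \<in> I \<Longrightarrow> u i \<in> L2 \<Omega>) \<Longrightarrow> (\<Sum>i\<in>I. u i) \<in> L2 \<Omega>"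
  by (induction I rule: infinite_finite_induct) (auto intro: L2_zero L2_add)

lemma L2_norm_sum_le:
  "(\<And>i. i \<in> I \<Longrightarrow> u i \<in> L2 \<Omega>) \<Longrightarrow> L2_norm \<Omega> (\<Sum>i\<in>I. u i) \<le> (\<Sum>i\<in>I. L2_norm \<Omega> (u i))"
proof (induction I rule: infinite_finite_induct)
  case (insert i I)
  then have "L2_norm \<Omega> (u i + (\<Sum>i\<in>I. u i)) \<le> L2_norm \<Omega> (u i) + L2_norm \<Omega> (\<Sum>i\<in>I. u i)"
    by (intro L2_norm_triangle L2_sum) auto
  also have "\<dots> \<le> L2_norm \<Omega> (u i) + (\<Sum>i\<in>I. L2_norm \<Omega> (u i))" using insert by simp
  finally show ?case unfolding sum.insert[OF insert(1,2)] .
qed (auto simp: L2_norm_def)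

lemma L2_inner_sum_left:
  "(\<And>i. i \<in> I \<Longrightarrow> u i \<in> L2 \<Omega>) \<Longrightarrow> w \<in> L2 \<Omega> \<Longrightarrow>
    L2_inner \<Omega> (\<Sum>i\<in>I. u i) w = (\<Sum>i\<in>I. L2_inner \<Omega> (u i) w)"
proof (induction I rule: infinite_finite_induct)
  case (insert i I)
  then have "L2_inner \<Omega> (u i + (\<Sum>i\<in>I. u i)) w = L2_inner \<Omega> (u i) w + L2_inner \<Omega> (\<Sum>i\<in>I. u i) w"
    by (intro L2_inner_add_left L2_sum) auto
  also have "\<dots> = L2_inner \<Omega> (u i) w + (\<Sum>i\<in>I. L2_inner \<Omega> (u i) w)" using insert by simp
  finally show ?case unfolding sum.insert[OF insert(1,2)] .
qed (auto simp: L2_inner_def)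

section \<open>Chains of neighbors and the distance\<close>

context
  fixes \<T> :: "'b set" and nb :: "'b \<Rightarrow> 'b \<Rightarrow> bool"
begin

lemma neighbor_chain_0: "neighbor_chain \<T> nb T T' 0 \<longleftrightarrow> T = T' \<and> T \<in> \<T>"
  by (auto simp: neighbor_chain_def intro: exI[of _ "\<lambda>_. T"])

lemma neighbor_chain_Suc:
  "neighbor_chain \<T> nb T T'' (Suc N) \<longleftrightarrow> (\<exists>T'. neighbor_chain \<T> nb T T' N \<and> nb T' T'' \<and> T'' \<in> \<T>)"
proof
  assume "neighbor_chain \<T> nb T T'' (Suc N)"
  then obtain S where S: "S 0 = T" "S (Suc N) = T''" "\<forall>j\<le>Suc N. S j \<in> \<T>"
    "\<forall>j\<in>{1..Suc N}. nb (S (j - 1)) (S j)"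
    unfolding neighbor_chain_def by blast
  then have "neighbor_chain \<T> nb T (S N) N" unfolding neighbor_chain_def
    by (intro exI[of _ S]) auto
  moreover have "nb (S N) T''" using S(2) bspec[OF S(4), of "Suc N"] by simp
  ultimately show "\<exists>T'. neighbor_chain \<T> nb T T' N \<and> nb T' T'' \<and> T'' \<in> \<T>" using S(2,3) by auto
next
  assume "\<exists>T'. neighbor_chain \<T> nb T T' N \<and> nb T' T'' \<and> T'' \<in> \<T>"
  then obtain S where S: "S 0 = T" "\<forall>j\<le>N. S j \<in> \<T>" "\<forall>j\<in>{1..N}. nb (S (j - 1)) (S j)"
    "nb (S N) T''" "T'' \<in> \<T>"
    unfolding neighbor_chain_def by blast
  then show "neighbor_chain \<T> nb T T'' (Suc N)" unfolding neighbor_chain_def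
    by (intro exI[of _ "S(Suc N := T'')"]) (auto simp: le_Suc_eq)
qed

lemma neighbor_chain_mem: "neighbor_chain \<T> nb T T' N \<Longrightarrow> T \<in> \<T> \<and> T' \<in> \<T>"
  by (auto simp: neighbor_chain_def)

lemma neighbor_chain_trans:
  "neighbor_chain \<T> nb T' T'' M \<Longrightarrow> neighbor_chain \<T> nb T T' N \<Longrightarrow> neighbor_chain \<T> nb T T'' (N + M)"
  by (induction M arbitrary: T'') (auto simp: neighbor_chain_0 neighbor_chain_Suc)

lemma neighbor_chain_sym:
  assumes nb: "\<And>T T'. T \<in> \<T> \<Longrightarrow> T' \<in> \<T> \<Longrightarrow> nb T T' \<Longrightarrow> nb T' T"
  shows "neighbor_chain \<T> nb T T' N \<Longrightarrow> neighbor_chain \<T> nb T' T N"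
proof (induction N arbitrary: T')
  case (Suc N)
  then obtain T1 where T1: "neighbor_chain \<T> nb T T1 N" "nb T1 T'" "T' \<in> \<T>"
    by (auto simp: neighbor_chain_Suc)
  have "neighbor_chain \<T> nb T' T1 1"
    using T1 nb neighbor_chain_mem[OF T1(1)] by (simp add: neighbor_chain_Suc neighbor_chain_0)
  from neighbor_chain_trans[OF Suc.IH[OF T1(1)] this] show ?case by simp
qed (simp add: neighbor_chain_0)

end

locale mesh_distance =
  fixes \<T> :: "'a set set" and \<delta> :: "'a set \<Rightarrow> 'a set \<Rightarrow> nat"
  assumes dist: "neighbor_distance \<T> \<delta>"
begin

lemma neighbors:
  obtains nb where "neighbor_relation \<T> nb"
    "\<And>T T'. T \<in> \<T> \<Longrightarrow> T' \<in> \<T> \<Longrightarrow> neighbor_chain \<T> nb T T' (\<delta> T T')"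
    "\<And>T T' N. neighbor_chain \<T> nb T T' N \<Longrightarrow> \<delta> T T' \<le> N"
proof -
  obtain nb where nb: "neighbor_relation \<T> nb"
    and \<delta>: "\<And>T T'. T \<in> \<T> \<Longrightarrow> T' \<in> \<T> \<Longrightarrow> \<delta> T T' = (LEAST N. neighbor_chain \<T> nb T T' N)"
    using dist unfolding neighbor_distance_def by blast
  show ?thesis
  proof (rule that[OF nb])
    show "neighbor_chain \<T> nb T T' (\<delta> T T')" if "T \<in> \<T>" "T' \<in> \<T>" for T T'
    proof -
      have "\<exists>N. neighbor_chain \<T> nb T T' N" using nb that unfolding neighbor_relation_def by blast
      then show ?thesis unfolding \<delta>[OF that] by (rule LeastI_ex)
    qed
    show "\<delta> T T' \<le> N" if "neighbor_chain \<T> nb T T' N" for T T' N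
      using that neighbor_chain_mem[OF that] \<delta>[of T T'] Least_le[of "neighbor_chain \<T> nb T T'" N] by simp
  qed
qed

lemma distance_refl: "T \<in> \<T> \<Longrightarrow> \<delta> T T = 0"
  using neighbors neighbor_chain_0 by (metis le_zero_eq)

lemma distance_sym: assumes "T \<in> \<T>" "T' \<in> \<T>" shows "\<delta> T T' = \<delta> T' T"
proof -
  obtain nb where nb: "neighbor_relation \<T> nb"
    "\<And>T T'. T \<in> \<T> \<Longrightarrow> T' \<in> \<T> \<Longrightarrow> neighbor_chain \<T> nb T T' (\<delta> T T')"
    "\<And>T T' N. neighbor_chain \<T> nb T T' N \<Longrightarrow> \<delta> T T' \<le> N"
    by (rule neighbors) blast
  have "neighbor_chain \<T> nb T' T (\<delta> T T')" "neighbor_chain \<T> nb T T' (\<delta> T' T)"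
    using nb(1) nb(2)[OF assms] nb(2)[OF assms(2,1)]
    by (auto simp: neighbor_relation_def intro: neighbor_chain_sym)
  then show ?thesis using nb(3) by (simp add: antisym)
qed

lemma distance_triangle:
  assumes "T \<in> \<T>" "T' \<in> \<T>" "T'' \<in> \<T>" shows "\<delta> T T'' \<le> \<delta> T T' + \<delta> T' T''"
proof -
  obtain nb where nb: "neighbor_relation \<T> nb"
    "\<And>T T'. T \<in> \<T> \<Longrightarrow> T' \<in> \<T> \<Longrightarrow> neighbor_chain \<T> nb T T' (\<delta> T T')"
    "\<And>T T' N. neighbor_chain \<T> nb T T' N \<Longrightarrow> \<delta> T T' \<le> N"
    by (rule neighbors) blast
  show ?thesis
    by (rule nb(3), rule neighbor_chain_trans[OF nb(2) nb(2)]) (use assms in auto)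
qed

text \<open>Induction along a shortest chain: consecutive members have distance exactly 1, at most 1
  by the one-step chain and not 0 because neighbors are distinct. It carries grading conditions from
  neighbors to arbitrary pairs of cells.\<close>

lemma lipschitz_from_neighbors:
  fixes l :: "'a set \<Rightarrow> int"
  assumes l: "\<And>T T'. T \<in> \<T> \<Longrightarrow> T' \<in> \<T> \<Longrightarrow> \<delta> T T' = 1 \<Longrightarrow> \<bar>l T - l T'\<bar> \<le> 1"
    and T: "T \<in> \<T>" "T' \<in> \<T>"
  shows "\<bar>l T - l T'\<bar> \<le> int (\<delta> T T')"
proof -
  obtain nb where nb: "neighbor_relation \<T> nb"
    "\<And>T T'. T \<in> \<T> \<Longrightarrow> T' \<in> \<T> \<Longrightarrow> neighbor_chain \<T> nb T T' (\<delta> T T')"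
    "\<And>T T' N. neighbor_chain \<T> nb T T' N \<Longrightarrow> \<delta> T T' \<le> N"
    by (rule neighbors) blast
  have one: "\<delta> T1 T2 = 1" if "T1 \<in> \<T>" "T2 \<in> \<T>" "nb T1 T2" for T1 T2
  proof -
    have "neighbor_chain \<T> nb T1 T2 1" using that by (simp add: neighbor_chain_Suc neighbor_chain_0)
    then have "\<delta> T1 T2 \<le> 1" by (rule nb(3))
    moreover have "\<delta> T1 T2 \<noteq> 0"
      using nb(1) nb(2)[OF that(1,2)] that by (auto simp: neighbor_relation_def neighbor_chain_0 intro: ccontr)
    ultimately show ?thesis by simp
  qed
  have "\<bar>l T - l T'\<bar> \<le> int N" if "neighbor_chain \<T> nb T T' N" for N T'
    using that
  proof (induction N arbitrary: T')
    case (Suc N)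
    then obtain T1 where T1: "neighbor_chain \<T> nb T T1 N" "nb T1 T'" "T' \<in> \<T>"
      by (auto simp: neighbor_chain_Suc)
    have "\<bar>l T1 - l T'\<bar> \<le> 1" using T1 neighbor_chain_mem[OF T1(1)] by (intro l one) auto
    then show ?case using Suc.IH[OF T1(1)] by simp
  qed (simp add: neighbor_chain_0)
  then show ?thesis using nb(2)[OF T] by blast
qed

end

section \<open>Exponential decay of the projection\<close>

context simplicial_mesh
begin

text \<open>Cutting off to interiors makes the pieces for different cells disjoint; the omitted
  frontiers are null.\<close>

definition on_cells :: "'a set set \<Rightarrow> ('a \<Rightarrow> real) \<Rightarrow> 'a \<Rightarrow> real" where
  "on_cells S f x = (if x \<in> (\<Union>T\<in>S. interior T) then f x else 0)"

lemma on_cells_sum: "on_cells S (\<Sum>i\<in>I. f i) = (\<Sum>i\<in>I. on_cells S (f i))"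
  by (auto simp: on_cells_def sum_fun_apply)

lemma on_cells_L2:
  assumes "S \<subseteq> \<T>" "f \<in> L2 \<Omega>" shows "on_cells S f \<in> L2 \<Omega>"
proof -
  have "(\<Union>T\<in>S. interior T) \<in> sets (lebesgue_on \<Omega>)"
    using assms(1) finite_mesh interior_cell_sets by (intro sets.finite_UN) (auto intro: finite_subset)
  then have "indicator (\<Union>T\<in>S. interior T) \<in> borel_measurable (lebesgue_on \<Omega>)"
    by (rule borel_measurable_indicator)
  then have "(\<lambda>x. indicator (\<Union>T\<in>S. interior T) x * f x) \<in> L2 \<Omega>"
    by (rule L2_bounded_mult[OF assms(2), where B = 1]) (auto simp: indicator_def)
  moreover have "(\<lambda>x. indicator (\<Union>T\<in>S. interior T) x * f x) = on_cells S f"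
    by (auto simp: on_cells_def indicator_def)
  ultimately show ?thesis by simp
qed

lemma on_cells_norm_le: "S \<subseteq> \<T> \<Longrightarrow> f \<in> L2 \<Omega> \<Longrightarrow> L2_norm \<Omega> (on_cells S f) \<le> L2_norm \<Omega> f"
  by (intro L2_norm_mono on_cells_L2) (auto simp: on_cells_def)

lemma on_cells_interior:
  assumes "S \<subseteq> \<T>" "T \<in> \<T>" "x \<in> interior T"
  shows "on_cells S f x = (if T \<in> S then f x else 0)"
proof -
  have "x \<notin> interior T'" if "T' \<in> \<T>" "T' \<noteq> T" for T'
    using interior_disjoint_cell[of T T'] that assms(2,3) interior_subset[of T'] by blast
  then show ?thesis using assms by (auto simp: on_cells_def)
qed

definition cells_at :: "('a set \<Rightarrow> int) \<Rightarrow> int \<Rightarrow> 'a set set" where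
  "cells_at l k = {T \<in> \<T>. l T = k}"

lemma cells_at_subset [simp]: "cells_at l k \<subseteq> \<T>"
  by (auto simp: cells_at_def)

lemma sum_on_cells_at:
  assumes "T \<in> \<T>" "x \<in> interior T"
  shows "(\<Sum>k\<in>l ` \<T>. on_cells (cells_at l k) f x) = f x"
proof -
  have "(\<Sum>k\<in>l ` \<T>. on_cells (cells_at l k) f x) = (\<Sum>k\<in>l ` \<T>. if k = l T then f x else 0)"
    by (intro sum.cong) (auto simp: on_cells_interior[OF _ assms] cells_at_def assms(1))
  then show ?thesis using assms(1) finite_mesh by simp
qed

lemma norm_square_partition:
  assumes f: "f \<in> L2 \<Omega>"
  shows "(L2_norm \<Omega> f)\<^sup>2 = (\<Sum>k\<in>l ` \<T>. (L2_norm \<Omega> (on_cells (cells_at l k) f))\<^sup>2)"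
proof -
  have L2: "on_cells (cells_at l k) f \<in> L2 \<Omega>" for k using f by (intro on_cells_L2) auto
  have "(L2_norm \<Omega> f)\<^sup>2 = (LINT x|lebesgue_on \<Omega>. (f x)\<^sup>2)" by (simp add: L2_norm_def)
  also have "\<dots> = (LINT x|lebesgue_on \<Omega>. (\<Sum>k\<in>l ` \<T>. (on_cells (cells_at l k) f x)\<^sup>2))"
  proof (rule integral_cong_AE)
    show "(\<lambda>x. (f x)\<^sup>2) \<in> borel_measurable (lebesgue_on \<Omega>)" using f by (auto simp: L2_def)
    show "(\<lambda>x. \<Sum>k\<in>l ` \<T>. (on_cells (cells_at l k) f x)\<^sup>2) \<in> borel_measurable (lebesgue_on \<Omega>)"
      using L2 by (intro borel_measurable_sum borel_measurable_power) (auto simp: L2_def)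
    show "AE x in lebesgue_on \<Omega>. (f x)\<^sup>2 = (\<Sum>k\<in>l ` \<T>. (on_cells (cells_at l k) f x)\<^sup>2)"
      using AE_interior
    proof eventually_elim
      case (elim x)
      then obtain T where T: "T \<in> \<T>" "x \<in> interior T" by blast
      have "(\<Sum>k\<in>l ` \<T>. (on_cells (cells_at l k) f x)\<^sup>2) =
          (\<Sum>k\<in>l ` \<T>. on_cells (cells_at l k) (\<lambda>x. (f x)\<^sup>2) x)"
        by (intro sum.cong) (auto simp: on_cells_def)
      then show ?case by (simp add: sum_on_cells_at[OF T])
    qed
  qed
  also have "\<dots> = (\<Sum>k\<in>l ` \<T>. LINT x|lebesgue_on \<Omega>. (on_cells (cells_at l k) f x)\<^sup>2)"
    using L2 by (intro Bochner_Integration.integral_sum) (auto simp: L2_def)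
  also have "\<dots> = (\<Sum>k\<in>l ` \<T>. (L2_norm \<Omega> (on_cells (cells_at l k) f))\<^sup>2)"
    by (simp add: L2_norm_def)
  finally show ?thesis .
qed

end

section \<open>The projection on representatives\<close>

locale mesh_projection = simplicial_mesh \<Omega> \<T>
  for \<Omega> :: "'a::euclidean_space set" and \<T> :: "'a set set" +
  fixes K :: nat and Q :: "('a \<Rightarrow> real) \<Rightarrow> 'a \<Rightarrow> real"
  assumes Q: "L2_projection \<Omega> (lagrange_space K \<T> \<Omega>) Q"
begin

definition Q0 :: "('a \<Rightarrow> real) \<Rightarrow> 'a \<Rightarrow> real" where "Q0 u = zero_ext (Q u)"

lemma Q0_fe_space: "u \<in> L2 \<Omega> \<Longrightarrow> Q0 u \<in> fe_space K"
  using Q by (auto simp: Q0_def L2_projection_def intro: zero_ext_fe_space)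

lemma Q_L2: "u \<in> L2 \<Omega> \<Longrightarrow> Q u \<in> L2 \<Omega>"
  using Q lagrange_space_L2 by (auto simp: L2_projection_def)

lemma Q0_L2: "u \<in> L2 \<Omega> \<Longrightarrow> Q0 u \<in> L2 \<Omega>"
  using Q0_fe_space fe_space_L2 by blast

lemma AE_Q0: "AE x in lebesgue_on \<Omega>. Q0 u x = Q u x"
  unfolding Q0_def by (rule AE_zero_ext)

lemma Q0_inner:
  assumes "u \<in> L2 \<Omega>" "v \<in> fe_space K" shows "L2_inner \<Omega> (Q0 u) v = L2_inner \<Omega> u v"
proof -
  have "L2_inner \<Omega> (Q0 u) v = L2_inner \<Omega> (Q u) v"
    using assms by (intro L2_inner_cong_AE Q0_L2 Q_L2 fe_space_L2[of v K] AE_Q0)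
  then show ?thesis using Q assms by (auto simp: L2_projection_def fe_space_def)
qed

text \<open>The difference is orthogonal to itself. Additivity and independence of the
  representative are not part of \<open>L2_projection\<close>; both are derived from this
  characterisation.\<close>

lemma Q0_unique:
  assumes u: "u \<in> L2 \<Omega>" and f: "f \<in> fe_space K"
    and *: "\<And>v. v \<in> fe_space K \<Longrightarrow> L2_inner \<Omega> f v = L2_inner \<Omega> u v"
  shows "Q0 u = f"
proof -
  interpret inner_subspace "fe_space K" "L2_inner \<Omega>" by (rule inner_subspace_fe_space)
  have d: "Q0 u - f \<in> fe_space K" using Q0_fe_space[OF u] f by simp
  have "L2_inner \<Omega> (Q0 u - f) (Q0 u - f) = 0"
    using d Q0_fe_space[OF u] f *[OF d] Q0_inner[OF u d] by (simp add: ip_diff_left)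
  then show ?thesis using ip_self_eq_0[OF d] by simp
qed

lemma Q0_norm_le: assumes u: "u \<in> L2 \<Omega>" shows "L2_norm \<Omega> (Q0 u) \<le> L2_norm \<Omega> u"
proof (cases "L2_norm \<Omega> (Q0 u) = 0")
  case False
  then have "L2_norm \<Omega> (Q0 u) > 0" using L2_norm_nonneg[of \<Omega> "Q0 u"] by linarith
  moreover have "L2_norm \<Omega> (Q0 u) * L2_norm \<Omega> (Q0 u) \<le> L2_norm \<Omega> u * L2_norm \<Omega> (Q0 u)"
    using L2_Cauchy_Schwarz[OF u Q0_L2[OF u]] Q0_inner[OF u Q0_fe_space[OF u]]
    by (simp add: L2_inner_self power2_eq_square)
  ultimately show ?thesis by simp
qed simp

lemma Q0_cong_AE:
  assumes "u \<in> L2 \<Omega>" "v \<in> L2 \<Omega>" "AE x in lebesgue_on \<Omega>. u x = v x" shows "Q0 u = Q0 v"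
  using assms
  by (intro Q0_unique Q0_fe_space) (simp_all add: Q0_inner L2_inner_cong_AE[OF assms(1,2) fe_space_L2 assms(3)])

lemma Q0_sum:
  assumes "\<And>i. i \<in> I \<Longrightarrow> u i \<in> L2 \<Omega>" shows "Q0 (\<Sum>i\<in>I. u i) = (\<Sum>i\<in>I. Q0 (u i))"
proof (rule Q0_unique)
  show "(\<Sum>i\<in>I. u i) \<in> L2 \<Omega>" using assms by (rule L2_sum)
  show "(\<Sum>i\<in>I. Q0 (u i)) \<in> fe_space K"
    using assms by (intro subspace_sum subspace_fe_space Q0_fe_space)
  show "L2_inner \<Omega> (\<Sum>i\<in>I. Q0 (u i)) v = L2_inner \<Omega> (\<Sum>i\<in>I. u i) v" if "v \<in> fe_space K" for v
    using assms that Q0_L2 by (simp add: L2_inner_sum_left Q0_inner fe_space_L2)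
qed

end

section \<open>The local operator and the decay estimate\<close>

locale local_operator = mesh_projection \<Omega> \<T> K Q + mesh_distance \<T> \<delta>
  for \<Omega> :: "'a::euclidean_space set" and \<T> :: "'a set set" and K :: nat
    and Q :: "('a \<Rightarrow> real) \<Rightarrow> 'a \<Rightarrow> real" and \<delta> :: "'a set \<Rightarrow> 'a set \<Rightarrow> nat" +
  fixes C :: "('a \<Rightarrow> real) \<Rightarrow> 'a \<Rightarrow> real"
  assumes linear: "L2_linear_operator \<Omega> (lagrange_space K \<T> \<Omega>) C"
    and self_adjoint: "L2_self_adjoint \<Omega> C"
    and elliptic: "eig_min \<Omega> (lagrange_space K \<T> \<Omega>) C > 0"
    and local: "support_growth_le_1 \<Omega> \<T> \<delta> C"
begin

definition C0 :: "('a \<Rightarrow> real) \<Rightarrow> 'a \<Rightarrow> real" where "C0 u = zero_ext (C u)"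

lemma C0_fe_space: "u \<in> L2 \<Omega> \<Longrightarrow> C0 u \<in> fe_space K"
  using linear by (auto simp: C0_def L2_linear_operator_def intro: zero_ext_fe_space)

lemma C_L2: "u \<in> L2 \<Omega> \<Longrightarrow> C u \<in> L2 \<Omega>"
  using linear lagrange_space_L2 by (auto simp: L2_linear_operator_def)

lemma C0_L2: "u \<in> L2 \<Omega> \<Longrightarrow> C0 u \<in> L2 \<Omega>"
  using C0_fe_space fe_space_L2 by blast

lemma AE_C0: "AE x in lebesgue_on \<Omega>. C0 u x = C u x"
  unfolding C0_def by (rule AE_zero_ext)

lemma C0_cong_AE:
  assumes "u \<in> L2 \<Omega>" "v \<in> L2 \<Omega>" "AE x in lebesgue_on \<Omega>. u x = v x" shows "C0 u = C0 v"
proof (rule fe_space_AE_eq)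
  have "AE x in lebesgue_on \<Omega>. C u x = C v x"
    using linear assms unfolding L2_linear_operator_def by blast
  then show "AE x in lebesgue_on \<Omega>. C0 u x = C0 v x"
    using AE_C0[of u] AE_C0[of v] by eventually_elim simp
qed (use assms in \<open>auto intro: C0_fe_space\<close>)

lemma C0_lincomb:
  assumes u: "u \<in> L2 \<Omega>" and v: "v \<in> L2 \<Omega>"
  shows "C0 (a *\<^sub>R u + b *\<^sub>R v) = a *\<^sub>R C0 u + b *\<^sub>R C0 v"
proof (rule fe_space_AE_eq)
  have eq: "a *\<^sub>R u + b *\<^sub>R v = (\<lambda>y. a * u y + b * v y)" by auto
  show "C0 (a *\<^sub>R u + b *\<^sub>R v) \<in> fe_space K"
    using u v by (intro C0_fe_space L2_add L2_scaleR)
  show "a *\<^sub>R C0 u + b *\<^sub>R C0 v \<in> fe_space K"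
    using u v by (intro fe_space_lincomb C0_fe_space)
  have "AE x in lebesgue_on \<Omega>. C (\<lambda>y. a * u y + b * v y) x = a * C u x + b * C v x"
    using linear u v by (auto simp: L2_linear_operator_def)
  then show "AE x in lebesgue_on \<Omega>. C0 (a *\<^sub>R u + b *\<^sub>R v) x = (a *\<^sub>R C0 u + b *\<^sub>R C0 v) x"
    using AE_C0[of u] AE_C0[of v] AE_C0[of "a *\<^sub>R u + b *\<^sub>R v"] unfolding eq by eventually_elim simp
qed

lemma C0_adjoint:
  assumes "u \<in> L2 \<Omega>" "v \<in> L2 \<Omega>" shows "L2_inner \<Omega> (C0 u) v = L2_inner \<Omega> u (C0 v)"
proof -
  have "L2_inner \<Omega> (C0 u) v = L2_inner \<Omega> (C u) v"
    using assms by (intro L2_inner_cong_AE C0_L2 C_L2 AE_C0)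
  also have "\<dots> = L2_inner \<Omega> u (C v)" using self_adjoint assms by (auto simp: L2_self_adjoint_def)
  also have "\<dots> = L2_inner \<Omega> u (C0 v)"
    using L2_inner_cong_AE[OF C0_L2 C_L2 assms(1) AE_C0, OF assms(2) assms(2)]
    by (simp add: L2_inner_commute)
  finally show ?thesis .
qed

sublocale op: self_adjoint_operator "fe_space K" "L2_inner \<Omega>" C0
proof (intro self_adjoint_operator.intro inner_subspace_fe_space self_adjoint_operator_axioms.intro)
  fix x y and a :: real assume xy: "x \<in> fe_space K" "y \<in> fe_space K"
  show "C0 (x + y) = C0 x + C0 y"
    using C0_lincomb[OF fe_space_L2 fe_space_L2, OF xy, of 1 1] by simp
  show "L2_inner \<Omega> (C0 x) y = L2_inner \<Omega> x (C0 y)"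
    using xy by (intro C0_adjoint fe_space_L2)
next
  fix x and a :: real assume x: "x \<in> fe_space K"
  show "C0 x \<in> fe_space K" using x by (intro C0_fe_space fe_space_L2)
  show "C0 (a *\<^sub>R x) = a *\<^sub>R C0 x"
    using C0_lincomb[OF fe_space_L2 fe_space_L2, OF x x, of a 0] by simp
qed

text \<open>Zero extension turns an eigenvector up to null sets into an exact one, so the abstract
  results on finiteness and extremality become available.\<close>

lemma eigenvalues_on_eq: "eigenvalues_on \<Omega> (lagrange_space K \<T> \<Omega>) C = op.eigenvalues"
proof (intro equalityI subsetI)
  fix l assume "l \<in> eigenvalues_on \<Omega> (lagrange_space K \<T> \<Omega>) C"
  then obtain v where v: "v \<in> lagrange_space K \<T> \<Omega>" "\<not> (AE x in lebesgue_on \<Omega>. v x = 0)"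
    "AE x in lebesgue_on \<Omega>. C v x = l * v x"
    by (auto simp: eigenvalues_on_def)
  define w where "w = zero_ext v"
  have w: "w \<in> fe_space K" unfolding w_def using v(1) by (rule zero_ext_fe_space)
  have wv: "AE x in lebesgue_on \<Omega>. w x = v x" unfolding w_def by (rule AE_zero_ext)
  have "w \<noteq> 0"
  proof
    assume "w = 0"
    have "AE x in lebesgue_on \<Omega>. v x = 0" using wv unfolding \<open>w = 0\<close> by eventually_elim simp
    then show False using v(2) by simp
  qed
  moreover have "C0 w = l *\<^sub>R w"
  proof (rule fe_space_AE_eq[where K = K])
    have "C0 w = C0 v" using wv by (intro C0_cong_AE fe_space_L2[OF w] lagrange_space_L2[OF v(1)])
    show "AE x in lebesgue_on \<Omega>. C0 w x = (l *\<^sub>R w) x"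
      using wv v(3) AE_C0[of v] unfolding \<open>C0 w = C0 v\<close> by eventually_elim simp
  qed (use w in \<open>auto intro: op.V_closed op.A_closed\<close>)
  ultimately show "l \<in> op.eigenvalues" using w by (auto simp: op.eigenvalues_def)
next
  fix l assume "l \<in> op.eigenvalues"
  then obtain v where v: "v \<in> fe_space K" "v \<noteq> 0" "C0 v = l *\<^sub>R v" by (auto simp: op.eigenvalues_def)
  have "\<not> (AE x in lebesgue_on \<Omega>. v x = 0)" using fe_space_AE_zero v by blast
  moreover have "AE x in lebesgue_on \<Omega>. C v x = l * v x"
    using AE_C0[of v] unfolding v(3) by eventually_elim simp
  ultimately show "l \<in> eigenvalues_on \<Omega> (lagrange_space K \<T> \<Omega>) C"
    using v(1) by (auto simp: eigenvalues_on_def fe_space_def)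
qed

lemma eigenvalue_bounds:
  defines "a \<equiv> eig_min \<Omega> (lagrange_space K \<T> \<Omega>) C" and "b \<equiv> eig_max \<Omega> (lagrange_space K \<T> \<Omega>) C"
  shows "0 < a" "a \<le> b" "op.eigenvalues \<subseteq> {a..b}"
proof -
  have ne: "op.eigenvalues \<noteq> {}" by (rule op.eigenvalues_nonempty[OF fe_space_nontrivial])
  show "0 < a" using elliptic by (simp add: a_def)
  show "op.eigenvalues \<subseteq> {a..b}"
    using op.finite_eigenvalues by (auto simp: a_def b_def eig_min_def eig_max_def eigenvalues_on_eq)
  then show "a \<le> b" using ne by auto
qed

text \<open>The Chebyshev convergence factor of the spectral interval, as in the classical conjugate
  gradient estimate.\<close>

definition rate :: real where
  "rate = (sqrt (cond2 \<Omega> (lagrange_space K \<T> \<Omega>) C) - 1) / (sqrt (cond2 \<Omega> (lagrange_space K \<T> \<Omega>) C) + 1)"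

lemma rate_eq:
  defines "a \<equiv> eig_min \<Omega> (lagrange_space K \<T> \<Omega>) C" and "b \<equiv> eig_max \<Omega> (lagrange_space K \<T> \<Omega>) C"
  shows "rate = (sqrt b - sqrt a) / (sqrt b + sqrt a)"
proof -
  have a: "0 < a" "a \<le> b" using eigenvalue_bounds by (simp_all add: a_def b_def)
  have "rate = (sqrt b / sqrt a - 1) / (sqrt b / sqrt a + 1)"
    by (simp add: rate_def cond2_def a_def b_def real_sqrt_divide)
  also have "\<dots> = ((sqrt b / sqrt a - 1) * sqrt a) / ((sqrt b / sqrt a + 1) * sqrt a)"
    using a by simp
  also have "\<dots> = (sqrt b - sqrt a) / (sqrt b + sqrt a)"
    using a by (simp add: algebra_simps)
  finally show ?thesis .
qed

lemma rate_nonneg: "0 \<le> rate"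
  unfolding rate_eq using eigenvalue_bounds(1,2) by simp

lemma C0_support:
  assumes u: "u \<in> L2 \<Omega>" and L: "L \<subseteq> \<T>" "\<And>T x. T \<in> \<T> - L \<Longrightarrow> x \<in> interior T \<Longrightarrow> u x = 0"
    and T: "T' \<in> \<T>" "x \<in> interior T'" "C0 u x \<noteq> 0"
  shows "\<exists>T\<in>L. \<delta> T' T \<le> 1"
proof -
  have "T' \<subseteq> ess_support \<Omega> (C0 u)"
    using fe_space_cell_subset_support[OF C0_fe_space[OF u]] T by blast
  also have "\<dots> = ess_support \<Omega> (C u)"
  proof -
    have "(AE y in lebesgue_on \<Omega>. y \<in> U \<longrightarrow> C0 u y = 0) \<longleftrightarrow> (AE y in lebesgue_on \<Omega>. y \<in> U \<longrightarrow> C u y = 0)" for U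
      by (intro AE_cong) (simp add: C0_def)
    then show ?thesis by (simp add: ess_support_def)
  qed
  finally have "T' \<subseteq> ess_support \<Omega> (C u)" .
  moreover have "ess_support \<Omega> u \<subseteq> \<Union>L" using L by (rule ess_support_subset_Union)
  ultimately show ?thesis using local u L(1) T(1) unfolding support_growth_le_1_def by blast
qed

text \<open>For a finite element function v, \<open>C0 v\<close> is again one, so <C Q u, v> = <Q u,
  C v> = <u, C v> = <C u, v>.\<close>

lemma C0_Q0: assumes u: "u \<in> L2 \<Omega>" shows "C0 (Q0 u) = C0 u"
proof -
  have d: "C0 (Q0 u) - C0 u \<in> fe_space K"
    using u by (intro op.V_closed C0_fe_space Q0_L2)
  have "L2_inner \<Omega> (C0 (Q0 u)) v = L2_inner \<Omega> (C0 u) v" if v: "v \<in> fe_space K" for v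
    using u v Q0_inner[OF u op.A_closed[OF v]] by (simp add: C0_adjoint Q0_L2 fe_space_L2)
  from this[OF d] have "L2_inner \<Omega> (C0 (Q0 u) - C0 u) (C0 (Q0 u) - C0 u) = 0"
    using d u by (simp add: op.ip_diff_left C0_fe_space Q0_L2)
  then show ?thesis using op.ip_self_eq_0[OF d] by simp
qed

text \<open>The instance of the filtration \<open>N\<close> in
  \<open>chebyshev_approximation\<close>. Quantifying over \<open>L\<close> avoids a minimum that
  would be undefined for empty \<open>L\<close>, where only the zero function remains.\<close>

definition near :: "'a set set \<Rightarrow> nat \<Rightarrow> ('a \<Rightarrow> real) set" where
  "near L m = {f \<in> fe_space K. \<forall>T\<in>\<T>. (\<forall>T0\<in>L. m < \<delta> T T0) \<longrightarrow> (\<forall>x\<in>interior T. f x = 0)}"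

lemma subspace_near: "subspace (near L m)"
  unfolding subspace_def near_def by (auto intro: op.V_closed)

lemma near_subset: "near L m \<subseteq> fe_space K"
  by (auto simp: near_def)

lemma near_mono: "near L m \<subseteq> near L (Suc m)"
  unfolding near_def using Suc_lessD by blast

text \<open>Stated for functions in \<open>L2 \<Omega>\<close> rather than members of
  \<open>near L m\<close>, since the first application is to \<open>u\<close>, which need not be a
  finite element function.\<close>

lemma C0_near_aux:
  assumes u: "u \<in> L2 \<Omega>" and L: "L \<subseteq> \<T>"
    and zero: "\<And>T x. T \<in> \<T> \<Longrightarrow> \<forall>T0\<in>L. m < \<delta> T T0 \<Longrightarrow> x \<in> interior T \<Longrightarrow> u x = 0"
  shows "C0 u \<in> near L (Suc m)"
  unfolding near_def
proof (intro CollectI conjI ballI impI)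
  show "C0 u \<in> fe_space K" using u by (rule C0_fe_space)
  fix T' x assume T': "T' \<in> \<T>" "\<forall>T0\<in>L. Suc m < \<delta> T' T0" "x \<in> interior T'"
  show "C0 u x = 0"
  proof (rule ccontr)
    assume ne: "C0 u x \<noteq> 0"
    define Lm where "Lm = {T \<in> \<T>. \<exists>T0\<in>L. \<delta> T T0 \<le> m}"
    have Lm: "Lm \<subseteq> \<T>" by (auto simp: Lm_def)
    have out: "u y = 0" if "T \<in> \<T> - Lm" "y \<in> interior T" for T y
      using that zero[of T y] by (auto simp: Lm_def not_le)
    obtain T where T: "T \<in> Lm" "\<delta> T' T \<le> 1"
      using C0_support[of u Lm T' x] u Lm out T'(1,3) ne by blast
    then obtain T0 where T0: "T \<in> \<T>" "T0 \<in> L" "\<delta> T T0 \<le> m" by (auto simp: Lm_def)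
    have "\<delta> T' T0 \<le> Suc m" using distance_triangle[of T' T T0] T T0 T' L by auto
    then show False using T'(2) T0(2) by auto
  qed
qed

text \<open>The Chebyshev approximant lies in \<open>near L m\<close> and vanishes on the interiors
  of the cells of \<open>S\<close>, so there \<open>Q0 u\<close> coincides with the approximation
  error.\<close>

lemma projection_decay:
  assumes u: "u \<in> L2 \<Omega>" and L: "L \<subseteq> \<T>" "\<And>T x. T \<in> \<T> - L \<Longrightarrow> x \<in> interior T \<Longrightarrow> u x = 0"
    and S: "S \<subseteq> \<T>" "\<And>T T0. T \<in> S \<Longrightarrow> T0 \<in> L \<Longrightarrow> m < \<delta> T T0"
  shows "L2_norm \<Omega> (on_cells S (Q0 u)) \<le> 2 * rate ^ m * L2_norm \<Omega> u"
proof -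
  have f: "Q0 u \<in> fe_space K" using u by (rule Q0_fe_space)
  have step: "C0 x \<in> near L (Suc k)" if "x \<in> near L k" for k x
    using that near_subset[of L k] by (intro C0_near_aux fe_space_L2 L(1)) (auto simp: near_def)
  \<comment> \<open>\<open>Q0 u\<close> has no local support, but \<open>C0 (Q0 u) = C0 u\<close>
    does. This is why the filtration starts with \<open>A f\<close> instead of
    \<open>f\<close>.\<close>
  have start: "C0 (Q0 u) \<in> near L 1"
    unfolding C0_Q0[OF u] One_nat_def
  proof (rule C0_near_aux[OF u L(1)])
    fix T x assume T: "T \<in> \<T>" "\<forall>T0\<in>L. 0 < \<delta> T T0" "x \<in> interior T"
    then have "T \<notin> L" using distance_refl by fastforce
    then show "u x = 0" using L(2) T by blast
  qed
  obtain y where y: "y \<in> near L m"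
    "L2_inner \<Omega> (Q0 u - y) (Q0 u - y) \<le> (2 * rate ^ m)\<^sup>2 * L2_inner \<Omega> (Q0 u) (Q0 u)"
    using op.chebyshev_approximation[OF f eigenvalue_bounds, of "near L" rate m]
      subspace_near near_subset near_mono step start rate_eq by blast
  have yL2: "Q0 u - y \<in> L2 \<Omega>" using y near_subset f by (intro fe_space_L2[of _ K] op.V_closed) auto
  have "on_cells S (Q0 u) = on_cells S (Q0 u - y)"
  proof
    fix x
    show "on_cells S (Q0 u) x = on_cells S (Q0 u - y) x"
      using y(1) S by (auto simp: on_cells_def near_def)
  qed
  then have "L2_norm \<Omega> (on_cells S (Q0 u)) \<le> L2_norm \<Omega> (Q0 u - y)"
    using on_cells_norm_le[OF S(1) yL2] by simp
  also have "\<dots> \<le> 2 * rate ^ m * L2_norm \<Omega> (Q0 u)"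
    using y(2) rate_nonneg unfolding L2_inner_self power_mult_distrib[symmetric]
    by (rule_tac power2_le_imp_le) auto
  also have "\<dots> \<le> 2 * rate ^ m * L2_norm \<Omega> u"
    using Q0_norm_le[OF u] rate_nonneg by (intro mult_left_mono) auto
  finally show ?thesis .
qed

end

section \<open>Weighted estimates\<close>

text \<open>Writing k as sqrt k times sqrt k, Cauchy-Schwarz uses the row sums; interchanging the
  summations then uses the column sums.\<close>

lemma schur_test:
  fixes k :: "'i \<Rightarrow> 'i \<Rightarrow> real" and b :: "'i \<Rightarrow> real"
  assumes pos: "\<And>i j. 0 \<le> k i j"
    and row: "\<And>i. i \<in> J \<Longrightarrow> (\<Sum>j\<in>J. k i j) \<le> S" and col: "\<And>j. j \<in> J \<Longrightarrow> (\<Sum>i\<in>J. k i j) \<le> S"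
    and S: "0 \<le> S"
  shows "(\<Sum>i\<in>J. (\<Sum>j\<in>J. k i j * b j)\<^sup>2) \<le> S\<^sup>2 * (\<Sum>j\<in>J. (b j)\<^sup>2)"
proof -
  have "(\<Sum>i\<in>J. (\<Sum>j\<in>J. k i j * b j)\<^sup>2) \<le> (\<Sum>i\<in>J. S * (\<Sum>j\<in>J. k i j * (b j)\<^sup>2))"
  proof (rule sum_mono)
    fix i assume i: "i \<in> J"
    have "(\<Sum>j\<in>J. k i j * b j)\<^sup>2 = (\<Sum>j\<in>J. sqrt (k i j) * (sqrt (k i j) * b j))\<^sup>2"
      using pos by (simp flip: mult.assoc)
    also have "\<dots> \<le> (\<Sum>j\<in>J. (sqrt (k i j))\<^sup>2) * (\<Sum>j\<in>J. (sqrt (k i j) * b j)\<^sup>2)"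
      by (rule Cauchy_Schwarz_ineq_sum)
    also have "\<dots> = (\<Sum>j\<in>J. k i j) * (\<Sum>j\<in>J. k i j * (b j)\<^sup>2)"
      using pos by (simp add: power_mult_distrib)
    also have "\<dots> \<le> S * (\<Sum>j\<in>J. k i j * (b j)\<^sup>2)"
      using row[OF i] pos by (intro mult_right_mono sum_nonneg) auto
    finally show "(\<Sum>j\<in>J. k i j * b j)\<^sup>2 \<le> S * (\<Sum>j\<in>J. k i j * (b j)\<^sup>2)" .
  qed
  also have "\<dots> = S * (\<Sum>j\<in>J. (\<Sum>i\<in>J. k i j) * (b j)\<^sup>2)"
    unfolding sum_distrib_left[symmetric] sum_distrib_right by (subst sum.swap) simp
  also have "\<dots> \<le> S * (\<Sum>j\<in>J. S * (b j)\<^sup>2)"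
    using col S by (intro mult_left_mono sum_mono mult_right_mono) auto
  finally show ?thesis by (simp add: sum_distrib_left power2_eq_square mult.assoc)
qed

text \<open>On the diagonal the projection is a contraction. For d > 0 the factor
  \<open>g ^ d\<close> compares the levels, and the exponent is d - 1 because the decay estimate
  with parameter m needs distance greater than m.\<close>

definition decay_kernel :: "real \<Rightarrow> real \<Rightarrow> nat \<Rightarrow> real" where
  "decay_kernel g q d = (if d = 0 then 1 else g ^ d * (2 * q ^ (d - 1)))"

lemma decay_kernel_sum:
  fixes J :: "int set"
  assumes J: "finite J" and g: "0 \<le> g" "0 \<le> q" "g * q < 1"
  shows "(\<Sum>k\<in>J. decay_kernel g q (nat \<bar>j - k\<bar>)) \<le> 1 + 4 * g / (1 - g * q)"
proof -
  have nonneg: "0 \<le> decay_kernel g q d" for d using g by (simp add: decay_kernel_def)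
  \<comment> \<open>A symmetric window allows an exact value: each d > 0 occurs on both sides of
    \<open>j\<close> and contributes 2 times 2 g (g q)^(d-1). Enclosing \<open>J\<close> in such a
    window makes the bound independent of \<open>J\<close>.\<close>
  have int_sum: "(\<Sum>k\<in>{j - int N..j + int N}. decay_kernel g q (nat \<bar>j - k\<bar>)) =
      1 + 4 * g * (\<Sum>i<N. (g * q) ^ i)" for N
  proof (induction N)
    case 0
    then show ?case by (simp add: decay_kernel_def)
  next
    case (Suc N)
    have "{j - int (Suc N)..j + int (Suc N)} =
        insert (j - int (Suc N)) (insert (j + int (Suc N)) {j - int N..j + int N})"
      by auto
    then have "(\<Sum>k\<in>{j - int (Suc N)..j + int (Suc N)}. decay_kernel g q (nat \<bar>j - k\<bar>)) =
        decay_kernel g q (Suc N) + (decay_kernel g q (Suc N) +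
          (\<Sum>k\<in>{j - int N..j + int N}. decay_kernel g q (nat \<bar>j - k\<bar>)))"
      by (simp add: nat_add_distrib)
    then show ?case
      unfolding Suc by (simp add: decay_kernel_def power_mult_distrib algebra_simps)
  qed
  have "\<exists>N. \<forall>k\<in>J. \<bar>j - k\<bar> \<le> int N"
  proof (intro exI ballI)
    fix k assume "k \<in> J"
    then have "nat \<bar>j - k\<bar> \<le> (\<Sum>k\<in>J. nat \<bar>j - k\<bar>)" using J by (intro member_le_sum) auto
    then show "\<bar>j - k\<bar> \<le> int (\<Sum>k\<in>J. nat \<bar>j - k\<bar>)" by linarith
  qed
  then obtain N where "\<forall>k\<in>J. \<bar>j - k\<bar> \<le> int N" by blast
  then have N: "J \<subseteq> {j - int N..j + int N}" by fastforce
  have "(\<Sum>k\<in>J. decay_kernel g q (nat \<bar>j - k\<bar>)) \<le> 1 + 4 * g * (\<Sum>i<N. (g * q) ^ i)"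
    using N nonneg unfolding int_sum[symmetric] by (intro sum_mono2) auto
  also have "(\<Sum>i<N. (g * q) ^ i) \<le> 1 / (1 - g * q)"
  proof -
    have "(1 - g * q) * (\<Sum>i<N. (g * q) ^ i) = 1 - (g * q) ^ N"
      by (rule one_diff_power_eq[symmetric])
    also have "\<dots> \<le> 1" using g by simp
    finally show ?thesis using g by (simp add: field_simps)
  qed
  finally show ?thesis using g by (simp add: mult_left_mono)
qed

context simplicial_mesh
begin

lemma cell_point:
  assumes T: "T \<in> \<T>" and P: "AE x in lebesgue_on \<Omega>. P x"
  obtains x where "x \<in> interior T" "P x"
proof (rule ccontr)
  assume *: "\<not> thesis"
  have "AE x in lebesgue. x \<in> \<Omega> \<longrightarrow> P x" using P by (subst (asm) AE_restrict_space_iff) auto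
  then have "AE x in lebesgue. x \<notin> interior T"
    by eventually_elim (use * that interior_cell_subset[OF T] in blast)
  then have "interior T \<in> null_sets lebesgue"
    by (subst (asm) AE_iff_null_sets[symmetric]) auto
  then show False
    using open_not_negligible[of "interior T"] cell_props(4)[OF T] by (simp add: negligible_iff_null_sets)
qed

lemma ess_sup_on_AE:
  assumes T: "T \<in> \<T>" shows "AE x in lebesgue_on \<Omega>. x \<in> T \<longrightarrow> ereal (f x) \<le> ess_sup_on \<Omega> T f"
proof -
  have "T \<in> sets lebesgue" using cell_props(2)[OF T] by auto
  then have "T \<inter> \<Omega> \<in> sets lebesgue" using sets_domain by blast
  then have "AE x in lebesgue. x \<in> T \<inter> \<Omega> \<longrightarrow> ereal (f x) \<le> ess_sup_on \<Omega> T f"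
    using esssup_AE[of "\<lambda>x. ereal (f x)" "lebesgue_on (T \<inter> \<Omega>)"] unfolding ess_sup_on_def
    by (subst (asm) AE_restrict_space_iff) auto
  then have "AE x in lebesgue. x \<in> \<Omega> \<longrightarrow> x \<in> T \<longrightarrow> ereal (f x) \<le> ess_sup_on \<Omega> T f"
    by eventually_elim blast
  then show ?thesis by (subst AE_restrict_space_iff) auto
qed

lemma weight_cell_values:
  assumes w: "weight_with_grading \<Omega> \<T> \<delta> \<rho> g"
  obtains r where "\<And>T. T \<in> \<T> \<Longrightarrow> 0 < r T"
    "\<And>T. T \<in> \<T> \<Longrightarrow> AE x in lebesgue_on \<Omega>. x \<in> T \<longrightarrow> r T / g \<le> \<rho> x \<and> \<rho> x \<le> r T"
    "\<And>T T'. T \<in> \<T> \<Longrightarrow> T' \<in> \<T> \<Longrightarrow> \<delta> T T' = 1 \<Longrightarrow> r T' \<le> g * r T"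
proof -
  have g: "1 \<le> g" using w by (simp add: weight_with_grading_def)
  have "\<exists>r. ess_sup_on \<Omega> T \<rho> = ereal r \<and> 0 < r \<and>
      (AE x in lebesgue_on \<Omega>. x \<in> T \<longrightarrow> r / g \<le> \<rho> x \<and> \<rho> x \<le> r)" if T: "T \<in> \<T>" for T
  proof -
    define s i where "s = ess_sup_on \<Omega> T \<rho>" and "i = ess_inf_on \<Omega> T \<rho>"
    have si: "s \<le> ereal g * i" using w T by (simp add: weight_with_grading_def s_def i_def)
    have s: "AE x in lebesgue_on \<Omega>. x \<in> T \<longrightarrow> ereal (\<rho> x) \<le> s"
      unfolding s_def by (rule ess_sup_on_AE[OF T])
    have "AE x in lebesgue_on \<Omega>. x \<in> T \<longrightarrow> ereal (- \<rho> x) \<le> - i"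
      using ess_sup_on_AE[OF T, of "\<lambda>x. - \<rho> x"] by (simp add: i_def ess_inf_on_def)
    then have i: "AE x in lebesgue_on \<Omega>. x \<in> T \<longrightarrow> i \<le> ereal (\<rho> x)"
      by eventually_elim (simp add: ereal_minus_le_minus flip: uminus_ereal.simps)
    have "AE x in lebesgue_on \<Omega>. 0 < \<rho> x" using w by (simp add: weight_with_grading_def)
    then have "AE x in lebesgue_on \<Omega>. x \<in> T \<longrightarrow> ereal (\<rho> x) \<le> s \<and> i \<le> ereal (\<rho> x) \<and> 0 < \<rho> x"
      using s i by eventually_elim blast
    \<comment> \<open>One sample point excludes infinite and zero values: 0 < \<rho>(x) \<le> s
      \<le> g \<rho>(x).\<close>
    from cell_point[OF T this] obtain x where
      x: "ereal (\<rho> x) \<le> s" "i \<le> ereal (\<rho> x)" "0 < \<rho> x"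
      using interior_subset by blast
    have "s \<le> ereal g * ereal (\<rho> x)"
      using si x(2) g by (meson ereal_less_eq(5) ereal_mult_left_mono order_trans zero_le_one)
    then obtain r where r: "s = ereal r" using x by (cases s) auto
    have r0: "0 < r" using x r by simp
    obtain i' where i': "i = ereal i'" using si r x(2) g by (cases i) auto
    have le: "r / g \<le> i'" using si r i' g by (simp add: field_simps)
    have "AE x in lebesgue_on \<Omega>. x \<in> T \<longrightarrow> r / g \<le> \<rho> x \<and> \<rho> x \<le> r"
      using s i unfolding r i' by eventually_elim (use le in auto)
    then show ?thesis using r r0 unfolding s_def by blast
  qed
  then obtain r where r: "\<And>T. T \<in> \<T> \<Longrightarrow> ess_sup_on \<Omega> T \<rho> = ereal (r T) \<and> 0 < r T \<and>
      (AE x in lebesgue_on \<Omega>. x \<in> T \<longrightarrow> r T / g \<le> \<rho> x \<and> \<rho> x \<le> r T)"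
    by metis
  have "r T' \<le> g * r T" if "T \<in> \<T>" "T' \<in> \<T>" "\<delta> T T' = 1" for T T'
  proof -
    have "ess_sup_on \<Omega> T' \<rho> \<le> ereal g * ess_sup_on \<Omega> T \<rho>"
      using w that by (simp add: weight_with_grading_def)
    then show ?thesis using r that by simp
  qed
  then show ?thesis using that r by blast
qed

end

section \<open>Weight levels and the weighted bound\<close>

context local_operator
begin

text \<open>
  The levels are rounded logarithms of the essential suprema to base \<open>g\<close>. For \<open>g = 1\<close>, where this makes
  no sense, all essential suprema coincide.
\<close>

lemma weight_levels:
  assumes w: "weight_with_grading \<Omega> \<T> \<delta> \<rho> g"
  obtains b :: real and l :: "'a set \<Rightarrow> int" where "0 < b"
    "\<And>T. T \<in> \<T> \<Longrightarrow> AE x in lebesgue_on \<Omega>. x \<in> T \<longrightarrow> b * g powi (l T - 1) \<le> \<rho> x \<and> \<rho> x \<le> b * g powi (l T + 1)"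
    "\<And>T T'. T \<in> \<T> \<Longrightarrow> T' \<in> \<T> \<Longrightarrow> \<bar>l T - l T'\<bar> \<le> int (\<delta> T T')"
proof -
  have g: "1 \<le> g" using w by (simp add: weight_with_grading_def)
  obtain r where r: "\<And>T. T \<in> \<T> \<Longrightarrow> 0 < r T"
    "\<And>T. T \<in> \<T> \<Longrightarrow> AE x in lebesgue_on \<Omega>. x \<in> T \<longrightarrow> r T / g \<le> \<rho> x \<and> \<rho> x \<le> r T"
    "\<And>T T'. T \<in> \<T> \<Longrightarrow> T' \<in> \<T> \<Longrightarrow> \<delta> T T' = 1 \<Longrightarrow> r T' \<le> g * r T"
    using weight_cell_values[OF w] by blast
  show ?thesis
  proof (cases "g = 1")
    case True
    have "\<Union>\<T> \<noteq> {}" unfolding Union_mesh using domain_nonempty by simp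
    then obtain T0 where T0: "T0 \<in> \<T>" by blast
    have eq: "r T = r T0" if T: "T \<in> \<T>" for T
    proof (rule ccontr)
      assume ne: "r T \<noteq> r T0"
      \<comment> \<open>\<open>l\<close> is constant along chains of neighbours, but would jump by more than the distance of \<open>T\<close> and \<open>T0\<close>.\<close>
      define l where "l T' = (if r T' = r T0 then 0 else int (\<delta> T T0) + 1)" for T'
      have "\<bar>l T1 - l T2\<bar> \<le> 1" if "T1 \<in> \<T>" "T2 \<in> \<T>" "\<delta> T1 T2 = 1" for T1 T2
      proof -
        have "r T1 = r T2"
          using r(3)[of T1 T2] r(3)[of T2 T1] that distance_sym[of T1 T2] True by auto
        then show ?thesis by (simp add: l_def)
      qed
      then have "\<bar>l T - l T0\<bar> \<le> int (\<delta> T T0)" using T T0 by (rule lipschitz_from_neighbors)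
      then show False using ne by (simp add: l_def)
    qed
    \<comment> \<open>All powers of g = 1 are 1, so the common essential supremum has to be carried
      by \<open>b\<close>.\<close>
    show ?thesis
    proof (rule that[of "r T0" "\<lambda>_. 0"])
      show "0 < r T0" using r(1) T0 by blast
      show "AE x in lebesgue_on \<Omega>. x \<in> T \<longrightarrow> r T0 * g powi (0 - 1) \<le> \<rho> x \<and> \<rho> x \<le> r T0 * g powi (0 + 1)"
        if "T \<in> \<T>" for T using r(2)[OF that] eq[OF that] True by simp
    qed auto
  next
    case False
    then have g1: "1 < g" using g by simp
    \<comment> \<open>Rounding down puts the essential supremum between g^l and g^(l+1); oscillation
      within the cell costs one more factor g below, hence the exponents l - 1 and l + 1.\<close>
    define l where "l T = \<lfloor>log g (r T)\<rfloor>" for T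
    have powi: "g powi k = g powr real_of_int k" for k using g1 by (simp add: powr_real_of_int')
    have lT: "g powi (l T) \<le> r T" "r T \<le> g powi (l T + 1)" if "T \<in> \<T>" for T
    proof -
      have "r T = g powr log g (r T)" using r(1)[OF that] g1 by simp
      moreover have "real_of_int (l T) \<le> log g (r T)" "log g (r T) \<le> real_of_int (l T + 1)"
        unfolding l_def by linarith+
      ultimately show "g powi (l T) \<le> r T" "r T \<le> g powi (l T + 1)"
        unfolding powi using g1 by (metis powr_le_cancel_iff)+
    qed
    show ?thesis
    proof (rule that[of 1 l])
      show "AE x in lebesgue_on \<Omega>. x \<in> T \<longrightarrow> 1 * g powi (l T - 1) \<le> \<rho> x \<and> \<rho> x \<le> 1 * g powi (l T + 1)"
        if T: "T \<in> \<T>" for T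
        using r(2)[OF T]
      proof eventually_elim
        case (elim x)
        have "g powi (l T - 1) \<le> r T / g"
          using lT(1)[OF T] g1 by (simp add: power_int_diff divide_right_mono)
        then show ?case using elim lT(2)[OF T] by auto
      qed
      show "\<bar>l T - l T'\<bar> \<le> int (\<delta> T T')" if "T \<in> \<T>" "T' \<in> \<T>" for T T'
      proof (rule lipschitz_from_neighbors[OF _ that])
        fix T1 T2 assume T: "T1 \<in> \<T>" "T2 \<in> \<T>" "\<delta> T1 T2 = 1"
        have le: "l T' \<le> l T + 1" if "T \<in> \<T>" "T' \<in> \<T>" "\<delta> T T' = 1" for T T'
        proof -
          have "log g (r T') \<le> log g (g * r T)"
            using r(3)[OF that] r(1)[OF that(1)] r(1)[OF that(2)] g1 by simp
          also have "\<dots> = 1 + log g (r T)" using r(1)[OF that(1)] g1 by (simp add: log_mult)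
          finally show ?thesis unfolding l_def by linarith
        qed
        show "\<bar>l T1 - l T2\<bar> \<le> 1" using le[OF T] le[of T2 T1] T distance_sym[of T1 T2] by auto
      qed
    qed simp
  qed
qed

text \<open>Cells of levels j and k are at distance at least |j - k|, so the part of the projection
  of level k seen on level j is controlled by \<open>decay_kernel\<close>, and Schur's test sums the
  levels.\<close>

lemma projection_levels:
  assumes g: "1 \<le> g" "g * rate < 1" and u: "u \<in> L2 \<Omega>"
    and l: "\<And>T T'. T \<in> \<T> \<Longrightarrow> T' \<in> \<T> \<Longrightarrow> \<bar>l T - l T'\<bar> \<le> int (\<delta> T T')"
  shows "(\<Sum>j\<in>l ` \<T>. (g powi j * L2_norm \<Omega> (on_cells (cells_at l j) (Q0 u)))\<^sup>2)
    \<le> (1 + 4 * g / (1 - g * rate))\<^sup>2 *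
      (\<Sum>k\<in>l ` \<T>. (g powi k * L2_norm \<Omega> (on_cells (cells_at l k) u))\<^sup>2)"
proof -
  define J where "J = l ` \<T>"
  define v where "v k = on_cells (cells_at l k) u" for k
  define b where "b k = L2_norm \<Omega> (v k)" for k
  define a where "a j = L2_norm \<Omega> (on_cells (cells_at l j) (Q0 u))" for j
  define ker where "ker j k = decay_kernel g rate (nat \<bar>j - k\<bar>)" for j k :: int
  have J: "finite J" using finite_mesh by (simp add: J_def)
  have v: "v k \<in> L2 \<Omega>" for k unfolding v_def using u by (intro on_cells_L2) auto
  have b: "0 \<le> b k" for k by (simp add: b_def)
  have "Q0 u = Q0 (\<Sum>k\<in>J. v k)"
  proof (rule Q0_cong_AE[OF u L2_sum])
    show "v k \<in> L2 \<Omega>" for k by (rule v)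
    show "AE x in lebesgue_on \<Omega>. u x = (\<Sum>k\<in>J. v k) x"
      using AE_interior
    proof eventually_elim
      case (elim x)
      then show ?case by (auto simp: sum_fun_apply v_def J_def sum_on_cells_at)
    qed
  qed
  then have Q: "Q0 u = (\<Sum>k\<in>J. Q0 (v k))" using v by (simp add: Q0_sum)
  have gpow: "0 < g powi j" for j using g by simp
  have shift: "g powi j \<le> g ^ nat \<bar>j - k\<bar> * g powi k" for j k
  proof -
    have "g powi (j - k) \<le> g powi \<bar>j - k\<bar>" using g by (intro power_int_increasing) auto
    then have "g powi (j - k) * g powi k \<le> g ^ nat \<bar>j - k\<bar> * g powi k"
      using gpow[of k] by (intro mult_right_mono) (auto simp: power_int_def)
    then show ?thesis using g by (simp flip: power_int_add)
  qed
  have piece: "g powi j * L2_norm \<Omega> (on_cells (cells_at l j) (Q0 (v k))) \<le> ker j k * (g powi k * b k)" for j k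
  proof (cases "j = k")
    case True
    have "L2_norm \<Omega> (on_cells (cells_at l j) (Q0 (v k))) \<le> b k"
      using on_cells_norm_le[OF cells_at_subset Q0_L2[OF v]] Q0_norm_le[OF v, of k] unfolding b_def
      by (rule order_trans)
    then show ?thesis using True gpow[of k] by (simp add: ker_def decay_kernel_def)
  next
    case False
    \<comment> \<open>The distance is at least |j - k| = m + 1, just above the threshold m of
      \<open>projection_decay\<close>.\<close>
    define m where "m = nat \<bar>j - k\<bar> - 1"
    have m: "nat \<bar>j - k\<bar> = Suc m" using False by (simp add: m_def)
    have "L2_norm \<Omega> (on_cells (cells_at l j) (Q0 (v k))) \<le> 2 * rate ^ m * b k"
      unfolding b_def
    proof (rule projection_decay[OF v, of "cells_at l k"])
      show "v k x = 0" if "T \<in> \<T> - cells_at l k" "x \<in> interior T" for T x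
        using that by (auto simp: v_def on_cells_interior[of _ T])
      show "m < \<delta> T T0" if "T \<in> cells_at l j" "T0 \<in> cells_at l k" for T T0
        using l[of T T0] that m by (auto simp: cells_at_def)
    qed auto
    then have "g powi j * L2_norm \<Omega> (on_cells (cells_at l j) (Q0 (v k)))
        \<le> (g ^ nat \<bar>j - k\<bar> * g powi k) * (2 * rate ^ m * b k)"
      using shift[of j k] gpow g(1) by (intro mult_mono) auto
    then show ?thesis using m by (simp add: ker_def decay_kernel_def mult_ac)
  qed
  have aj: "g powi j * a j \<le> (\<Sum>k\<in>J. ker j k * (g powi k * b k))" for j
  proof -
    have "a j \<le> (\<Sum>k\<in>J. L2_norm \<Omega> (on_cells (cells_at l j) (Q0 (v k))))"
      unfolding a_def Q on_cells_sum using v by (intro L2_norm_sum_le on_cells_L2 Q0_L2) auto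
    then have "g powi j * a j \<le> g powi j * (\<Sum>k\<in>J. L2_norm \<Omega> (on_cells (cells_at l j) (Q0 (v k))))"
      using gpow[of j] by (intro mult_left_mono) auto
    also have "\<dots> \<le> (\<Sum>k\<in>J. ker j k * (g powi k * b k))"
      unfolding sum_distrib_left by (intro sum_mono piece)
    finally show ?thesis .
  qed
  have "(\<Sum>j\<in>J. (g powi j * a j)\<^sup>2) \<le> (\<Sum>j\<in>J. (\<Sum>k\<in>J. ker j k * (g powi k * b k))\<^sup>2)"
    using aj gpow by (intro sum_mono power_mono) (auto simp: a_def less_imp_le)
  also have "\<dots> \<le> (1 + 4 * g / (1 - g * rate))\<^sup>2 * (\<Sum>k\<in>J. (g powi k * b k)\<^sup>2)"
  proof (rule schur_test)
    show "0 \<le> ker i j" for i j using g rate_nonneg by (simp add: ker_def decay_kernel_def)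
    show "(\<Sum>k\<in>J. ker j k) \<le> 1 + 4 * g / (1 - g * rate)" for j
      unfolding ker_def using J g rate_nonneg by (intro decay_kernel_sum) auto
    then show "(\<Sum>j\<in>J. ker j k) \<le> 1 + 4 * g / (1 - g * rate)" for k
      by (simp add: ker_def abs_minus_commute[of _ k])
    show "0 \<le> 1 + 4 * g / (1 - g * rate)" using g by simp
  qed
  finally show ?thesis by (simp add: a_def b_def v_def J_def)
qed

lemma weighted_projection_bound:
  assumes w: "weight_with_grading \<Omega> \<T> \<delta> \<rho> g" and g: "g * rate < 1" and u: "u \<in> L2 \<Omega>"
  shows "L2_norm \<Omega> (\<lambda>x. \<rho> x * Q u x) \<le> 6 * g ^ 3 / (1 - g * rate) * L2_norm \<Omega> (\<lambda>x. \<rho> x * u x)"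
proof -
  have g1: "1 \<le> g" using w by (simp add: weight_with_grading_def)
  obtain b :: real and l :: "'a set \<Rightarrow> int" where b: "0 < b"
    and \<rho>: "\<And>T. T \<in> \<T> \<Longrightarrow> AE x in lebesgue_on \<Omega>. x \<in> T \<longrightarrow> b * g powi (l T - 1) \<le> \<rho> x \<and> \<rho> x \<le> b * g powi (l T + 1)"
    and l: "\<And>T T'. T \<in> \<T> \<Longrightarrow> T' \<in> \<T> \<Longrightarrow> \<bar>l T - l T'\<bar> \<le> int (\<delta> T T')"
    using weight_levels[OF w] by blast
  define S where "S = 1 + 4 * g / (1 - g * rate)"
  have gpow: "0 < g powi j" for j using g1 by simp
  have "AE x in lebesgue_on \<Omega>. \<forall>T\<in>\<T>. x \<in> T \<longrightarrow> b * g powi (l T - 1) \<le> \<rho> x \<and> \<rho> x \<le> b * g powi (l T + 1)"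
    using \<rho> finite_mesh by (intro AE_finite_allI)
  then have level: "AE x in lebesgue_on \<Omega>. \<exists>T\<in>\<T>. x \<in> interior T \<and> b * g powi (l T - 1) \<le> \<rho> x \<and> \<rho> x \<le> b * g powi (l T + 1)"
    using AE_interior
  proof eventually_elim
    case (elim x)
    then show ?case using interior_subset by blast
  qed
  have \<rho>_L2: "(\<lambda>x. \<rho> x * f x) \<in> L2 \<Omega>" if f: "f \<in> L2 \<Omega>" for f
  proof (rule L2_bounded_mult[OF f])
    show "\<rho> \<in> borel_measurable (lebesgue_on \<Omega>)" using w by (auto simp: weight_with_grading_def)
    show "AE x in lebesgue_on \<Omega>. \<bar>\<rho> x\<bar> \<le> (\<Sum>T\<in>\<T>. b * g powi (l T + 1))"
      using level
    proof eventually_elim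
      case (elim x)
      then obtain T where T: "T \<in> \<T>" "b * g powi (l T - 1) \<le> \<rho> x" "\<rho> x \<le> b * g powi (l T + 1)" by blast
      have "0 \<le> \<rho> x" using T(2) b gpow[of "l T - 1"] by (meson less_imp_le mult_pos_pos order_trans)
      moreover have "b * g powi (l T + 1) \<le> (\<Sum>T\<in>\<T>. b * g powi (l T + 1))"
        using T(1) finite_mesh b gpow by (intro member_le_sum) (auto simp: less_imp_le)
      ultimately show ?case using T(3) by simp
    qed
  qed
  \<comment> \<open>On level j the weight is at most b g^(j+1): the first of the two factors g lost
    to rounding. The second is lost in \<open>lower\<close>, from the bound b g^(k-1) below.\<close>
  have upper: "L2_norm \<Omega> (on_cells (cells_at l j) (\<lambda>x. \<rho> x * f x)) \<le>
      b * g * (g powi j * L2_norm \<Omega> (on_cells (cells_at l j) f))" if f: "f \<in> L2 \<Omega>" for f j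
  proof -
    have "L2_norm \<Omega> (on_cells (cells_at l j) (\<lambda>x. \<rho> x * f x)) \<le>
        L2_norm \<Omega> ((b * g powi (j + 1)) *\<^sub>R on_cells (cells_at l j) f)"
    proof (rule L2_norm_mono)
      show "AE x in lebesgue_on \<Omega>. \<bar>on_cells (cells_at l j) (\<lambda>x. \<rho> x * f x) x\<bar> \<le>
          \<bar>((b * g powi (j + 1)) *\<^sub>R on_cells (cells_at l j) f) x\<bar>"
        using level
      proof eventually_elim
        case (elim x)
        then obtain T where T: "T \<in> \<T>" "x \<in> interior T" "b * g powi (l T - 1) \<le> \<rho> x"
          "\<rho> x \<le> b * g powi (l T + 1)" by blast
        have "0 \<le> \<rho> x" using T(3) b gpow[of "l T - 1"] by (meson less_imp_le mult_pos_pos order_trans)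
        show ?case
        proof (cases "T \<in> cells_at l j")
          case True
          then have "\<bar>\<rho> x\<bar> \<le> \<bar>b * g powi (j + 1)\<bar>" using T(4) \<open>0 \<le> \<rho> x\<close> by (simp add: cells_at_def)
          then show ?thesis
            unfolding scaleR_fun_apply real_scaleR_def on_cells_interior[OF cells_at_subset T(1,2)] abs_mult[of "\<rho> x"]
              abs_mult[of "b * g powi (j + 1)"] if_P[OF True]
            by (intro mult_right_mono) auto
        qed (simp add: on_cells_interior[OF cells_at_subset T(1,2)])
      qed
    qed (intro L2_scaleR on_cells_L2 cells_at_subset \<rho>_L2 f)+
    also have "\<dots> = b * g * (g powi j * L2_norm \<Omega> (on_cells (cells_at l j) f))"
      using b g1 gpow[of j] by (simp add: L2_norm_scaleR power_int_add abs_mult)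
    finally show ?thesis .
  qed
  have lower: "b * (g powi k * L2_norm \<Omega> (on_cells (cells_at l k) u)) \<le>
      g * L2_norm \<Omega> (on_cells (cells_at l k) (\<lambda>x. \<rho> x * u x))" for k
  proof -
    have "L2_norm \<Omega> ((b * g powi k) *\<^sub>R on_cells (cells_at l k) u) \<le>
        L2_norm \<Omega> (g *\<^sub>R on_cells (cells_at l k) (\<lambda>x. \<rho> x * u x))"
    proof (rule L2_norm_mono)
      show "AE x in lebesgue_on \<Omega>. \<bar>((b * g powi k) *\<^sub>R on_cells (cells_at l k) u) x\<bar> \<le>
          \<bar>(g *\<^sub>R on_cells (cells_at l k) (\<lambda>x. \<rho> x * u x)) x\<bar>"
        using level
      proof eventually_elim
        case (elim x)
        then obtain T where T: "T \<in> \<T>" "x \<in> interior T" "b * g powi (l T - 1) \<le> \<rho> x" by blast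
        have "0 \<le> \<rho> x" using T(3) b gpow[of "l T - 1"] by (meson less_imp_le mult_pos_pos order_trans)
        moreover have "b * g powi (l T) \<le> g * \<rho> x"
          using mult_left_mono[OF T(3), of g] g1 by (simp add: power_int_diff field_simps)
        ultimately have le: "\<bar>b * g powi (l T)\<bar> \<le> \<bar>g * \<rho> x\<bar>" using b g1 gpow[of "l T"] by (simp add: abs_mult)
        show ?case
        proof (cases "T \<in> cells_at l k")
          case True
          then have "\<bar>b * g powi k\<bar> \<le> \<bar>g * \<rho> x\<bar>" using le by (simp add: cells_at_def)
          then show ?thesis
            unfolding scaleR_fun_apply real_scaleR_def on_cells_interior[OF cells_at_subset T(1,2)] if_P[OF True]
              mult.assoc[of g, symmetric] abs_mult[of "g * \<rho> x"] abs_mult[of "b * g powi k"]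
            by (intro mult_right_mono) auto
        qed (simp add: on_cells_interior[OF cells_at_subset T(1,2)])
      qed
    qed (intro L2_scaleR on_cells_L2 cells_at_subset \<rho>_L2 u)+
    then show ?thesis using b g1 gpow[of k] by (simp add: L2_norm_scaleR abs_mult mult.assoc)
  qed
  have S0: "0 \<le> S" using g g1 by (simp add: S_def)
  have "(L2_norm \<Omega> (\<lambda>x. \<rho> x * Q u x))\<^sup>2 = (L2_norm \<Omega> (\<lambda>x. \<rho> x * Q0 u x))\<^sup>2"
  proof -
    have "AE x in lebesgue_on \<Omega>. \<rho> x * Q u x = \<rho> x * Q0 u x" using AE_Q0[of u] by eventually_elim simp
    then show ?thesis using L2_norm_cong_AE[OF \<rho>_L2[OF Q_L2[OF u]] \<rho>_L2[OF Q0_L2[OF u]]] by simp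
  qed
  also have "\<dots> = (\<Sum>j\<in>l ` \<T>. (L2_norm \<Omega> (on_cells (cells_at l j) (\<lambda>x. \<rho> x * Q0 u x)))\<^sup>2)"
    by (rule norm_square_partition[OF \<rho>_L2[OF Q0_L2[OF u]]])
  also have "\<dots> \<le> (\<Sum>j\<in>l ` \<T>. (b * g * (g powi j * L2_norm \<Omega> (on_cells (cells_at l j) (Q0 u))))\<^sup>2)"
    using u by (intro sum_mono power_mono upper Q0_L2) auto
  also have "\<dots> = (b * g)\<^sup>2 * (\<Sum>j\<in>l ` \<T>. (g powi j * L2_norm \<Omega> (on_cells (cells_at l j) (Q0 u)))\<^sup>2)"
    by (simp only: power_mult_distrib[of "b * g"] sum_distrib_left)
  also have "\<dots> \<le> (b * g)\<^sup>2 * (S\<^sup>2 * (\<Sum>k\<in>l ` \<T>. (g powi k * L2_norm \<Omega> (on_cells (cells_at l k) u))\<^sup>2))"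
    unfolding S_def by (intro mult_left_mono projection_levels[OF g1 g u l]) auto
  \<comment> \<open>The scale \<open>b\<close> moves from the outer factor into the sum, where
    \<open>lower\<close> cancels it.\<close>
  also have "\<dots> = (g * S)\<^sup>2 * (\<Sum>k\<in>l ` \<T>. (b * (g powi k * L2_norm \<Omega> (on_cells (cells_at l k) u)))\<^sup>2)"
    unfolding power_mult_distrib[of b] power_mult_distrib[of g S] power_mult_distrib[of b g]
      sum_distrib_left[symmetric] by (simp only: mult_ac)
  also have "\<dots> \<le> (g * S)\<^sup>2 * (\<Sum>k\<in>l ` \<T>. (g * L2_norm \<Omega> (on_cells (cells_at l k) (\<lambda>x. \<rho> x * u x)))\<^sup>2)"
    using b gpow by (intro mult_left_mono sum_mono power_mono lower) (auto simp: less_imp_le)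
  also have "\<dots> = (g * S * g * L2_norm \<Omega> (\<lambda>x. \<rho> x * u x))\<^sup>2"
    by (simp add: power_mult_distrib norm_square_partition[OF \<rho>_L2[OF u], of l] sum_distrib_left mult_ac)
  finally have "L2_norm \<Omega> (\<lambda>x. \<rho> x * Q u x) \<le> g * S * g * L2_norm \<Omega> (\<lambda>x. \<rho> x * u x)"
    by (rule power2_le_imp_le) (use S0 g1 in auto)
  also have "\<dots> \<le> 6 * g ^ 3 / (1 - g * rate) * L2_norm \<Omega> (\<lambda>x. \<rho> x * u x)"
  proof (rule mult_right_mono)
    have d: "0 < 1 - g * rate" using g by simp
    have "S = (1 - g * rate + 4 * g) / (1 - g * rate)" using d by (simp add: S_def field_simps)
    \<comment> \<open>g \<ge> 1 absorbs the summand 1, so S is at most a multiple of g / (1 - g q);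
      with the two lost factors this gives the cube.\<close>
    also have "\<dots> \<le> 6 * g / (1 - g * rate)"
    proof (rule divide_right_mono)
      have "0 \<le> g * rate" using g1 rate_nonneg by simp
      then show "1 - g * rate + 4 * g \<le> 6 * g" using g1 by linarith
    qed (use d in simp)
    finally have "g * g * S \<le> g * g * (6 * g / (1 - g * rate))" using g1 by (intro mult_left_mono) auto
    then show "g * S * g \<le> 6 * g ^ 3 / (1 - g * rate)" by (simp add: power3_eq_cube mult_ac)
  qed simp
  finally show ?thesis .
qed

end

theorem theorem4p4:
  fixes \<Omega> :: "'a::euclidean_space set"
    and \<T> :: "'a set set"
    and K :: nat
    and V :: "('a \<Rightarrow> real) set"
    and Q C :: "('a \<Rightarrow> real) \<Rightarrow> 'a \<Rightarrow> real"
    and \<delta> :: "'a set \<Rightarrow> 'a set \<Rightarrow> nat"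
    and \<kappa> q :: real
  assumes "polyhedral_domain \<Omega>"
    and "triangulation_of \<T> \<Omega>"
    and "K \<ge> 1"
    and V: "V = lagrange_space K \<T> \<Omega>"
    and Q: "L2_projection \<Omega> V Q"
    and C1: "L2_linear_operator \<Omega> V C" "L2_self_adjoint \<Omega> C"
    and C2: "eig_min \<Omega> V C > 0"
    and C3: "neighbor_distance \<T> \<delta>"
    and C4: "support_growth_le_1 \<Omega> \<T> \<delta> C"
    and \<kappa>: "\<kappa> = cond2 \<Omega> V C"
    and q: "q = (sqrt \<kappa> - 1) / (sqrt \<kappa> + 1)"
  shows "(\<forall>\<rho> \<gamma>. weight_with_grading \<Omega> \<T> \<delta> \<rho> \<gamma> \<and> ereal \<gamma> < 1 / ereal q \<longrightarrow>
            (\<forall>u \<in> L2 \<Omega>. L2_norm \<Omega> (\<lambda>x. \<rho> x * Q u x)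
                          \<le> 6 * \<gamma> ^ 3 / (1 - \<gamma> * q) * L2_norm \<Omega> (\<lambda>x. \<rho> x * u x)))
         \<and> 1 / ereal q \<le> worst_grading \<Omega> \<T> \<delta> Q"
proof -
  interpret local_operator \<Omega> \<T> K Q \<delta> C
    using assms by unfold_locales (simp_all add: V)
  have rate: "rate = q" by (simp add: rate_def q \<kappa> V)
  have q0: "0 \<le> q" using rate_nonneg by (simp add: rate)
  \<comment> \<open>For q = 0 the extended quotient is infinite and puts no restriction on \<gamma>,
    but then \<gamma> q = 0 < 1 anyway.\<close>
  have less1: "\<gamma> * q < 1" if "ereal \<gamma> < 1 / ereal q" for \<gamma>
  proof (cases "q = 0")
    case False
    then have "1 / ereal q = ereal (1 / q)" by (simp add: one_ereal_def del: ereal_eq_1)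
    then have "\<gamma> < 1 / q" using that by simp
    then show ?thesis using False q0 by (simp add: field_simps)
  qed simp
  have bound: "\<forall>u \<in> L2 \<Omega>. L2_norm \<Omega> (\<lambda>x. \<rho> x * Q u x)
      \<le> 6 * \<gamma> ^ 3 / (1 - \<gamma> * q) * L2_norm \<Omega> (\<lambda>x. \<rho> x * u x)"
    if "weight_with_grading \<Omega> \<T> \<delta> \<rho> \<gamma>" "ereal \<gamma> < 1 / ereal q" for \<rho> \<gamma>
    using weighted_projection_bound[OF that(1)] less1[OF that(2)] by (simp add: rate)
  moreover have "1 / ereal q \<le> worst_grading \<Omega> \<T> \<delta> Q"
    unfolding worst_grading_def
  \<comment> \<open>1 / q itself belongs to the set, because the constant found above depends on the
    weight only through \<gamma>.\<close>
  proof (rule Sup_upper, intro CollectI allI impI)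
    fix \<gamma> :: real assume "1 \<le> \<gamma>" "ereal \<gamma> < 1 / ereal q"
    then show "\<exists>c. \<forall>\<rho>. weight_with_grading \<Omega> \<T> \<delta> \<rho> \<gamma> \<longrightarrow>
        (\<forall>u\<in>L2 \<Omega>. L2_norm \<Omega> (\<lambda>x. \<rho> x * Q u x) \<le> c * L2_norm \<Omega> (\<lambda>x. \<rho> x * u x))"
      using bound by (intro exI[of _ "6 * \<gamma> ^ 3 / (1 - \<gamma> * q)"]) blast
  qed
  ultimately show ?thesis by blast
qed

end
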